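(* As $n\to\infty$, $$s_n = \frac{n!}{\mathrm{e}^2}\left(1 - \frac{4}{n} + \frac{2}{n(n-1)} + O(n^{-3})\right).$$
   Context: A block of a permutation $\pi$ of $\{1,\ldots,n\}$ is a nonempty set of consecutive positions whose set of values under $\pi$ is a set of consecutive integers. A permutation of length $n$ is simple if its only blocks are the singletons and $\{1,\ldots,n\}$. $s_n$ is the number of simple permutations of length $n$, and $\mathrm{e}$ is the base of the natural logarithm. *)

theory Defs
  imports Complex_Main "HOL-Library.Landau_Symbols" "HOL-Combinatorics.Permutations"
begin

(* Nonempty on both sides: a \<le> b, and the image of a nonempty set is nonempty. *)
definition is_block :: "nat \<Rightarrow> (nat \<Rightarrow> nat) \<Rightarrow> nat set \<Rightarrow> bool" where
  "is_block n p B \<longleftrightarrow>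
     B \<subseteq> {1..n} \<and> (\<exists>a b. a \<le> b \<and> B = {a..b}) \<and> (\<exists>c d. p ` B = {c..d})"

definition simple_perm :: "nat \<Rightarrow> (nat \<Rightarrow> nat) \<Rightarrow> bool" where
  "simple_perm n p \<longleftrightarrow>
     p permutes {1..n} \<and> (\<forall>B. is_block n p B \<longrightarrow> (\<exists>i. B = {i}) \<or> B = {1..n})"

(* Each permutation is counted once: p permutes {1..n} forces p to be the identity off {1..n}. *)
definition num_simple :: "nat \<Rightarrow> nat" where
  "num_simple n = card {p. simple_perm n p}"

end

theory Submission
  imports Defs "HOL-Computational_Algebra.Formal_Power_Series" "HOL-Analysis.Uniform_Limit"
    "HOL-Real_Asymp.Real_Asymp"
begin

text \<open>
  A permutation of length \<open>n\<close> is not simple exactly when it has a block of some length \<open>k\<close> with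
  \<open>2 \<le> k \<le> n - 1\<close>.  A given interval of \<open>k\<close> positions is mapped onto a given interval of \<open>k\<close>
  values by \<open>k! (n - k)!\<close> permutations, and there are \<open>(n - k + 1)^2\<close> pairs of such intervals; hence
  all blocks with \<open>5 \<le> k \<le> n - 3\<close> together spoil only \<open>O((n - 3)!)\<close> permutations
  (\<open>card_wide_block_perms\<close>), which is within the error term.  The few remaining lengths
  decide the expansion.

  Length 2.  A block of length 2 is an adjacency: neighbouring positions with neighbouring values.  Let
  \<open>H n\<close> be the number of permutations without adjacencies.  By inclusion-exclusion over the set of
  positions at which adjacencies are prescribed, \<open>H n\<close> is the coefficient of \<open>x^n\<close> in \<open>F(y)\<close>, where
  \<open>F(x) = (\<Sum>r. r! x^r)\<close> and \<open>y = x (1 - x) / (1 + x)\<close> (\<open>adj_free_eq_fps_nth\<close>).  The equation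
  \<open>F = 1 + x F + x^2 F'\<close> turns into a linear recurrence for \<open>H\<close>, and for the proportions
  \<open>h n = H n / n!\<close> the recurrence says \<open>h n - h (n - 1) = 4 h n / n^3 + O(n^(-4))\<close>.  The number of
  adjacencies is asymptotically Poisson with mean 2, so \<open>h n\<close> tends to \<open>exp (-2)\<close>; summing the
  differences from \<open>n\<close> to infinity gives \<open>h n = exp (-2) (1 - 2 / n^2 + O(n^(-3)))\<close>
  (\<open>adj_free_ratio_expansion\<close>).

  Lengths 3, \<open>n - 2\<close> and \<open>n - 1\<close>.  A block of length 3 contains an adjacency.  A block of length
  \<open>n - 1\<close> or \<open>n - 2\<close> forces an adjacency or a corner, that is, one of the extreme values at one of the
  extreme positions.  Removing a corner leaves a shorter permutation without adjacencies that lacks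
  one particular corner, and so the number of permutations with neither adjacency nor corner is
  \<open>H n - 4 H (n - 1) + 6 H (n - 2) + O((n - 3)!)\<close> (\<open>card_corner_free_expansion\<close>).

  Length 4.  A block of length 4 without adjacencies has one of the two patterns 2413 and 3142, and
  shrinking it to a point gives a permutation of length \<open>n - 3\<close> whose adjacencies all involve that
  point.  Conversely, inflating a point of a simple permutation by one of the two patterns can be
  undone.  Since most adjacency-free permutations are simple, the upper and the lower bound that this
  gives for the number of permutations with a block of length 4, but neither adjacency nor corner, are
  both \<open>2 (n - 3) H (n - 3) + O((n - 3)!)\<close> (\<open>card_four_block_perms_le\<close>, \<open>card_four_block_perms_ge\<close>).

  Together, \<open>s n = H n - 4 H (n - 1) + 6 H (n - 2) - 2 (n - 3) H (n - 3) + O((n - 3)!)\<close>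
  (\<open>card_simple_expansion\<close>); dividing by \<open>n!\<close> and inserting the expansion of \<open>h\<close> gives the theorem.
\<close>

section \<open>Permutations and the insertion of a last entry\<close>

definition perms :: "nat \<Rightarrow> (nat \<Rightarrow> nat) set" where
  "perms n = {p. p permutes {1..n}}"

lemma finite_perms [simp]: "finite (perms n)"
  by (simp add: perms_def finite_permutations)

lemma card_perms: "card (perms n) = fact n"
  by (simp add: perms_def card_permutations)

definition adj :: "(nat \<Rightarrow> nat) \<Rightarrow> nat \<Rightarrow> bool" where
  "adj p i \<longleftrightarrow> p (Suc i) = Suc (p i) \<or> p i = Suc (p (Suc i))"

definition insert_last :: "nat \<Rightarrow> nat \<Rightarrow> (nat \<Rightarrow> nat) \<Rightarrow> nat \<Rightarrow> nat" where
  "insert_last n v q i = (if i = Suc n then v else if Suc n < i then i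
     else if v \<le> q i then Suc (q i) else q i)"

lemma perms_range: "p \<in> perms n \<Longrightarrow> i \<in> {1..n} \<Longrightarrow> p i \<in> {1..n}"
  using permutes_in_image[of p "{1..n}" i] by (auto simp: perms_def)

lemma perms_inj: "p \<in> perms n \<Longrightarrow> p i = p j \<Longrightarrow> i = j"
  using permutes_inj[of p "{1..n}"] by (auto simp: perms_def dest: injD)

lemma perms_outside: "p \<in> perms n \<Longrightarrow> i \<notin> {1..n} \<Longrightarrow> p i = i"
  using permutes_not_in[of p "{1..n}" i] by (auto simp: perms_def)

lemma permsI:
  assumes "\<And>i. i \<in> {1..n} \<Longrightarrow> p i \<in> {1..n}" "inj_on p {1..n}" "\<And>i. i \<notin> {1..n} \<Longrightarrow> p i = i"
  shows "p \<in> perms n"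
proof -
  have "p ` {1..n} = {1..n}"
    using assms(1,2) by (intro endo_inj_surj) auto
  then have "bij_betw p {1..n} {1..n}"
    using assms(2) by (simp add: bij_betw_def)
  then show ?thesis
    using assms(3) unfolding perms_def by (auto intro!: bij_imp_permutes)
qed

lemma insert_last_perms:
  assumes q: "q \<in> perms n" and v: "v \<in> {1..Suc n}"
  shows "insert_last n v q \<in> perms (Suc n)"
proof (rule permsI)
  show "insert_last n v q i \<in> {1..Suc n}" if "i \<in> {1..Suc n}" for i
    using that v perms_range[OF q, of i] by (auto simp: insert_last_def)
  show "inj_on (insert_last n v q) {1..Suc n}"
    by (rule inj_onI) (auto simp: insert_last_def split: if_splits dest: perms_inj[OF q])
  show "insert_last n v q i = i" if "i \<notin> {1..Suc n}" for i
  proof (cases "i = 0")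
    case True
    then show ?thesis using perms_outside[OF q, of 0] v by (auto simp: insert_last_def)
  qed (use that in \<open>auto simp: insert_last_def\<close>)
qed

lemma insert_last_inj:
  "inj_on (\<lambda>(v, q). insert_last n v q) ({1..Suc n} \<times> perms n)"
proof (rule inj_onI, clarify)
  fix v q w r
  assume q: "q \<in> perms n" and r: "r \<in> perms n" and eq: "insert_last n v q = insert_last n w r"
  have vw: "v = w"
    using fun_cong[OF eq, of "Suc n"] by (simp add: insert_last_def)
  have "q i = r i" for i
  proof (cases "i \<in> {1..n}")
    case True
    then show ?thesis
      using fun_cong[OF eq, of i] vw by (auto simp: insert_last_def split: if_splits)
  next
    case False
    then show ?thesis using q r by (simp add: perms_outside)
  qed
  then show "v = w \<and> q = r" using vw by auto
qed

lemma insert_last_bij: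
  "bij_betw (\<lambda>(v, q). insert_last n v q) ({1..Suc n} \<times> perms n) (perms (Suc n))"
proof -
  let ?f = "\<lambda>(v, q). insert_last n v q" and ?A = "{1..Suc n} \<times> perms n"
  have "?f ` ?A \<subseteq> perms (Suc n)"
    using insert_last_perms by auto
  moreover have "card (?f ` ?A) = card (perms (Suc n))"
    unfolding card_image[OF insert_last_inj] by (simp add: card_cartesian_product card_perms)
  ultimately have "?f ` ?A = perms (Suc n)"
    by (intro card_subset_eq) auto
  then show ?thesis using insert_last_inj unfolding bij_betw_def by blast
qed

text \<open>Splitting off the last entry reduces every count over permutations of length \<open>n + 1\<close>
  to counting, for each permutation of length \<open>n\<close>, the admissible last values.\<close>
lemma card_perms_Suc:
  "card {p \<in> perms (Suc n). P p} = (\<Sum>q\<in>perms n. card {v \<in> {1..Suc n}. P (insert_last n v q)})"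
proof -
  let ?f = "\<lambda>(v, q). insert_last n v q"
  have "?f ` {x \<in> {1..Suc n} \<times> perms n. P (?f x)} = {p \<in> ?f ` ({1..Suc n} \<times> perms n). P p}"
    by blast
  then have "?f ` {x \<in> {1..Suc n} \<times> perms n. P (?f x)} = {p \<in> perms (Suc n). P p}"
    by (simp only: bij_betw_imp_surj_on[OF insert_last_bij])
  then have "bij_betw ?f {x \<in> {1..Suc n} \<times> perms n. P (?f x)} {p \<in> perms (Suc n). P p}"
    by (intro bij_betw_imageI inj_on_subset[OF insert_last_inj]) auto
  then have "card {p \<in> perms (Suc n). P p} = card {x \<in> {1..Suc n} \<times> perms n. P (?f x)}"
    by (simp add: bij_betw_same_card)
  also have "{x \<in> {1..Suc n} \<times> perms n. P (?f x)}
      = (\<lambda>(q, v). (v, q)) ` (SIGMA q:perms n. {v \<in> {1..Suc n}. P (insert_last n v q)})"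
    by auto
  also have "card \<dots> = card (SIGMA q:perms n. {v \<in> {1..Suc n}. P (insert_last n v q)})"
    by (rule card_image) (auto simp: inj_on_def)
  also have "\<dots> = (\<Sum>q\<in>perms n. card {v \<in> {1..Suc n}. P (insert_last n v q)})"
    by (subst card_SigmaI) auto
  finally show ?thesis .
qed

text \<open>A new last value \<open>v\<close> pushes up all values from \<open>v\<close> on, so it destroys an adjacency
  exactly when it separates the two values, that is, when it equals the larger one; it
  creates none among old positions.\<close>
lemma adj_insert_last:
  assumes "Suc i \<le> n"
  shows "adj (insert_last n v q) i \<longleftrightarrow> adj q i \<and> v \<noteq> max (q i) (q (Suc i))"
  using assms by (auto simp: adj_def insert_last_def max_def)

lemma adj_insert_last_new:
  "adj (insert_last (Suc n) v q) (Suc n) \<longleftrightarrow> v = q (Suc n) \<or> v = Suc (q (Suc n))"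
  by (auto simp: adj_def insert_last_def)

lemma adj_insert_last_all:
  assumes "S \<subseteq> {1..<n}"
  shows "(\<forall>i\<in>S. adj (insert_last n v q) i) \<longleftrightarrow>
    (\<forall>i\<in>S. adj q i) \<and> v \<notin> (\<lambda>i. max (q i) (q (Suc i))) ` S"
proof -
  have "adj (insert_last n v q) i \<longleftrightarrow> adj q i \<and> v \<noteq> max (q i) (q (Suc i))" if "i \<in> S" for i
    using that assms by (intro adj_insert_last) auto
  then show ?thesis by blast
qed

definition adj_count :: "nat \<Rightarrow> nat set \<Rightarrow> nat" where
  "adj_count n S = card {p \<in> perms n. \<forall>i\<in>S. adj p i}"

text
  \<open>Distinct adjacencies are destroyed by distinct last values: an adjacency with larger value \<open>m\<close>
  occupies the positions of \<open>m - 1\<close> and \<open>m\<close>.\<close>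
lemma adj_max_inj:
  assumes q: "q \<in> perms n" and S: "\<And>i. i \<in> S \<Longrightarrow> adj q i"
  shows "inj_on (\<lambda>i. max (q i) (q (Suc i))) S"
proof (rule inj_onI)
  fix i j assume ij: "i \<in> S" "j \<in> S" and eq: "max (q i) (q (Suc i)) = max (q j) (q (Suc j))"
  have "q i = q j \<or> q i = q (Suc j) \<and> q (Suc i) = q j"
    using S[OF ij(1)] S[OF ij(2)] eq by (auto simp: adj_def max_def split: if_splits)
  then show "i = j"
    by (auto dest!: perms_inj[OF q])
qed

text
  \<open>If no adjacency is prescribed at the last pair of positions, the last value has to avoid one value for each prescribed adjacency.\<close>
lemma adj_count_extend:
  assumes S: "S \<subseteq> {1..<n}"
  shows "adj_count (Suc n) S = (Suc n - card S) * adj_count n S"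
proof -
  have "card {v \<in> {1..Suc n}. \<forall>i\<in>S. adj (insert_last n v q) i}
      = (if \<forall>i\<in>S. adj q i then Suc n - card S else 0)" if q: "q \<in> perms n" for q
  proof (cases "\<forall>i\<in>S. adj q i")
    case True
    let ?M = "(\<lambda>i. max (q i) (q (Suc i))) ` S"
    have "{v \<in> {1..Suc n}. \<forall>i\<in>S. adj (insert_last n v q) i} = {1..Suc n} - ?M"
      using True by (auto simp: adj_insert_last_all[OF S])
    moreover have "?M \<subseteq> {1..Suc n}"
    proof (rule image_subsetI)
      fix i assume "i \<in> S"
      then have "i \<in> {1..n}" "Suc i \<in> {1..n}" using S by auto
      then show "max (q i) (q (Suc i)) \<in> {1..Suc n}"
        using perms_range[OF q, of i] perms_range[OF q, of "Suc i"] by (auto simp: max_def)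
    qed
    moreover have "card ?M = card S"
      using adj_max_inj[OF q, of S] True by (simp add: card_image)
    ultimately show ?thesis
      using True by (simp add: card_Diff_subset finite_subset)
  next
    case False
    then show ?thesis unfolding adj_insert_last_all[OF S] by auto
  qed
  then have "adj_count (Suc n) S = (\<Sum>q\<in>perms n. if \<forall>i\<in>S. adj q i then Suc n - card S else 0)"
    unfolding adj_count_def card_perms_Suc[of n "\<lambda>p. \<forall>i\<in>S. adj p i"] by (intro sum.cong) auto
  also have "\<dots> = (Suc n - card S) * adj_count n S"
    by (simp add: adj_count_def sum.If_cases Int_def mult.commute)
  finally show ?thesis .
qed

text
  \<open>If an adjacency is prescribed at the last pair of positions, the last entry has to go directly below or above its neighbour; when the pair before is prescribed as well, one of these two choices breaks that earlier adjacency.\<close>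
lemma adj_count_glue:
  assumes S: "S \<subseteq> {1..<Suc n}"
  shows "adj_count (Suc (Suc n)) (insert (Suc n) S) =
    (if n \<in> S then 1 else 2) * adj_count (Suc n) S"
proof -
  let ?N = "Suc n"
  have "card {v \<in> {1..Suc ?N}. \<forall>i\<in>insert ?N S. adj (insert_last ?N v q) i}
      = (if \<forall>i\<in>S. adj q i then (if n \<in> S then 1 else 2) else 0)" if q: "q \<in> perms ?N" for q
  proof (cases "\<forall>i\<in>S. adj q i")
    case True
    let ?u = "q ?N"
    have u: "?u \<in> {1..?N}" using perms_range[OF q, of ?N] by simp
    have *: "{v \<in> {1..Suc ?N}. \<forall>i\<in>insert ?N S. adj (insert_last ?N v q) i}
        = {?u, Suc ?u} - (\<lambda>i. max (q i) (q (Suc i))) ` S"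
      using True u by (auto simp: adj_insert_last_all[OF S] adj_insert_last_new)
    (* Only the adjacency at position n can be broken: no other one involves the value q (Suc n). *)
    have only: "i = n" if "i \<in> S" and "max (q i) (q (Suc i)) \<in> {?u, Suc ?u}" for i
    proof -
      have "q i = ?u \<or> q (Suc i) = ?u"
        using True that by (auto simp: adj_def max_def split: if_splits)
      then show ?thesis using perms_inj[OF q] that(1) S by force
    qed
    show ?thesis
    proof (cases "n \<in> S")
      case nS: True
      have "max (q n) ?u \<in> {?u, Suc ?u}"
        using True nS by (auto simp: adj_def max_def)
      moreover have "{?u, Suc ?u} - (\<lambda>i. max (q i) (q (Suc i))) ` S = {?u, Suc ?u} - {max (q n) ?u}"
        using only nS by blast
      ultimately have "card ({?u, Suc ?u} - (\<lambda>i. max (q i) (q (Suc i))) ` S) = 1"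
        by (simp only: card_Diff_singleton) simp
      then show ?thesis unfolding * using True nS by simp
    next
      case False
      then have "{?u, Suc ?u} - (\<lambda>i. max (q i) (q (Suc i))) ` S = {?u, Suc ?u}"
        using only by blast
      then show ?thesis unfolding * using True False by simp
    qed
  next
    case False
    then show ?thesis by (auto simp: adj_insert_last_all[OF S])
  qed
  then have "adj_count (Suc ?N) (insert ?N S)
      = (\<Sum>q\<in>perms ?N. if \<forall>i\<in>S. adj q i then (if n \<in> S then 1 else 2) else 0)"
    unfolding adj_count_def card_perms_Suc[of ?N "\<lambda>p. \<forall>i\<in>insert ?N S. adj p i"]
    by (intro sum.cong) auto
  also have "\<dots> = (if n \<in> S then 1 else 2) * adj_count ?N S"
    by (simp add: adj_count_def sum.If_cases Int_def mult.commute)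
  finally show ?thesis .
qed

section \<open>Inclusion-exclusion over adjacencies\<close>

text \<open>The number of maximal intervals in \<open>S\<close>, provided that \<open>0 \<notin> S\<close>: because of the
  truncated subtraction, an interval starting at 0 would be missed.\<close>
definition runs :: "nat set \<Rightarrow> nat" where
  "runs S = card {i \<in> S. i - 1 \<notin> S}"

lemma runs_insert:
  assumes "S \<subseteq> {1..<Suc n}"
  shows "runs (insert (Suc n) S) = runs S + (if n \<in> S then 0 else 1)"
proof -
  have fin: "finite S" using assms by (rule finite_subset) simp
  have "{i \<in> insert (Suc n) S. i - 1 \<notin> insert (Suc n) S}
      = {i \<in> S. i - 1 \<notin> S} \<union> (if n \<in> S then {} else {Suc n})"
    using assms by (auto simp: subset_iff)
  moreover have "card ({i \<in> S. i - 1 \<notin> S} \<union> (if n \<in> S then {} else {Suc n}))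
      = card {i \<in> S. i - 1 \<notin> S} + card (if n \<in> S then {} else {Suc n})"
    using fin assms by (intro card_Un_disjoint) auto
  ultimately show ?thesis unfolding runs_def by simp
qed

lemma runs_le_card: "finite S \<Longrightarrow> runs S \<le> card S"
  unfolding runs_def by (intro card_mono) auto

lemma card_positions_less:
  assumes "S \<subseteq> {1..<n}"
  shows "card S \<le> n - 1"
  using card_mono[OF _ assms] by simp

text \<open>Gluing the prescribed adjacencies leaves \<open>n - card S\<close> entries to be permuted, and
  every run of glued positions is increasing or decreasing.\<close>
lemma adj_count_eq:
  "S \<subseteq> {1..<n} \<Longrightarrow> adj_count n S = 2 ^ runs S * fact (n - card S)"
proof (induction n arbitrary: S)
  case 0
  then show ?case by (simp add: adj_count_def runs_def perms_def)
next
  case (Suc n)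
  show ?case
  proof (cases "n \<in> S")
    case False
    then have S: "S \<subseteq> {1..<n}" using Suc.prems by (auto simp: less_Suc_eq subset_iff)
    have "card S \<le> n" using card_positions_less[OF S] by simp
    then show ?thesis
      using Suc.IH[OF S] by (simp add: adj_count_extend[OF S] Suc_diff_le algebra_simps)
  next
    case True
    then obtain m where n: "n = Suc m" using Suc.prems by (cases n) auto
    define T where "T = S - {n}"
    have T: "T \<subseteq> {1..<n}" and S: "S = insert n T" "n \<notin> T"
      using Suc.prems True by (auto simp: T_def less_Suc_eq subset_iff)
    have fin: "finite T" using T by (rule finite_subset) simp
    have "adj_count (Suc n) S = (if m \<in> T then 1 else 2) * adj_count n T"
      using adj_count_glue[of T m] T n S by simp
    also have "\<dots> = 2 ^ runs S * fact (n - card T)"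
      using runs_insert[of T m] T n S Suc.IH[OF T] by simp
    finally show ?thesis using S fin by simp
  qed
qed

definition adj_free :: "nat \<Rightarrow> (nat \<Rightarrow> nat) set" where
  "adj_free n = {p \<in> perms n. \<forall>i\<in>{1..<n}. \<not> adj p i}"

lemma finite_adj_free [simp]: "finite (adj_free n)"
  by (simp add: adj_free_def)

text \<open>The product of \<open>1 - [adj p i]\<close> over all positions is the indicator of having no
  adjacency; expand it.\<close>
lemma adj_free_incl_excl:
  "real (card (adj_free n)) = (\<Sum>S\<in>Pow {1..<n}. (-1) ^ card S * real (adj_count n S))"
proof -
  have "(\<Sum>S\<in>Pow {1..<n}. (-1) ^ card S * (if \<forall>i\<in>S. adj p i then 1 else 0 :: real))
      = (if \<forall>i\<in>{1..<n}. \<not> adj p i then 1 else 0)" for p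
  proof -
    have "(\<Prod>i\<in>{1..<n}. (1::real) - (if adj p i then 1 else 0))
        = (\<Sum>S\<in>Pow {1..<n}. (-1) ^ card S * (\<Prod>i\<in>S. if adj p i then 1 else 0) * (\<Prod>i\<in>{1..<n}-S. 1))"
      by (rule prod_diff_conv_sum) simp
    moreover have "\<dots> = (\<Sum>S\<in>Pow {1..<n}. (-1) ^ card S * (if \<forall>i\<in>S. adj p i then 1 else 0))"
    proof (rule sum.cong[OF refl])
      fix S assume "S \<in> Pow {1..<n}"
      then have "finite S" using finite_subset[of S "{1..<n}"] by simp
      then have "(\<Prod>i\<in>S. if adj p i then 1 else 0 :: real) = (if \<forall>i\<in>S. adj p i then 1 else 0)"
        by (induction S) auto
      then show "(-1) ^ card S * (\<Prod>i\<in>S. if adj p i then 1 else 0) * (\<Prod>i\<in>{1..<n}-S. 1)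
          = (-1) ^ card S * (if \<forall>i\<in>S. adj p i then 1 else 0 :: real)"
        by simp
    qed
    moreover have "(\<Prod>i\<in>{1..<n}. (1::real) - (if adj p i then 1 else 0))
        = (if \<forall>i\<in>{1..<n}. \<not> adj p i then 1 else 0)"
    proof (cases "\<forall>i\<in>{1..<n}. \<not> adj p i")
      case True
      then show ?thesis by simp
    next
      case False
      then obtain i where "i \<in> {1..<n}" "adj p i" by blast
      then show ?thesis by (subst prod_zero) (auto intro!: bexI[of _ i])
    qed
    ultimately show ?thesis by metis
  qed
  note * = this
  have "real (card (adj_free n)) = (\<Sum>p\<in>perms n. if \<forall>i\<in>{1..<n}. \<not> adj p i then 1 else 0)"
    by (simp add: adj_free_def sum.If_cases Int_def)
  also have "\<dots> = (\<Sum>S\<in>Pow {1..<n}. \<Sum>p\<in>perms n. (-1) ^ card S * (if \<forall>i\<in>S. adj p i then 1 else 0 :: real))"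
    unfolding *[symmetric] by (rule sum.swap)
  also have "\<dots> = (\<Sum>S\<in>Pow {1..<n}. (-1) ^ card S * real (adj_count n S))"
    by (intro sum.cong) (simp_all add: sum_distrib_left[symmetric] adj_count_def sum.If_cases Int_def)
  finally show ?thesis .
qed

definition run_sum :: "nat \<Rightarrow> nat \<Rightarrow> nat" where
  "run_sum n j = (\<Sum>S | S \<subseteq> {1..<n} \<and> card S = j. 2 ^ runs S)"

lemma adj_free_eq_run_sum:
  assumes "n > 0"
  shows "real (card (adj_free n)) = (\<Sum>j\<le>n. (-1) ^ j * real (run_sum n j) * fact (n - j))"
proof -
  have "real (card (adj_free n)) = (\<Sum>S\<in>Pow {1..<n}. (-1) ^ card S * (2 ^ runs S * fact (n - card S)))"
    unfolding adj_free_incl_excl by (intro sum.cong) (auto simp: adj_count_eq)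
  also have "\<dots> = (\<Sum>j\<le>n. \<Sum>S | S \<in> Pow {1..<n} \<and> card S = j. (-1) ^ card S * (2 ^ runs S * fact (n - card S)))"
  proof (rule sum.group[symmetric])
    show "card ` Pow {1..<n} \<subseteq> {..n}"
    proof (rule image_subsetI)
      fix S assume "S \<in> Pow {1..<n}"
      then show "card S \<in> {..n}" using card_positions_less[of S n] by simp
    qed
  qed auto
  also have "\<dots> = (\<Sum>j\<le>n. (-1) ^ j * real (run_sum n j) * fact (n - j))"
    by (intro sum.cong) (auto simp: run_sum_def sum_distrib_left sum_distrib_right intro!: sum.cong)
  finally show ?thesis .
qed

lemma run_sum_0: "run_sum n 0 = 1"
proof -
  have "{S. S \<subseteq> {1..<n} \<and> card S = 0} = {{}}"
    by (auto simp: finite_subset[of _ "{Suc 0..<n}"])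
  then show ?thesis by (simp add: run_sum_def runs_def)
qed

lemma run_sum_eq_0: "n \<le> j \<Longrightarrow> 0 < j \<Longrightarrow> run_sum n j = 0"
proof -
  assume "n \<le> j" "0 < j"
  then have "\<not> (S \<subseteq> {1..<n} \<and> card S = j)" for S
    using card_positions_less[of S n] by auto
  then have "{S. S \<subseteq> {1..<n} \<and> card S = j} = {}"
    by blast
  then show ?thesis unfolding run_sum_def by simp
qed

text \<open>A set of positions either avoids or contains the largest admissible position.\<close>
lemma run_sum_split:
  "run_sum (Suc (Suc n)) (Suc j) = run_sum (Suc n) (Suc j)
     + (\<Sum>S | S \<subseteq> {1..<Suc n} \<and> card S = j. 2 ^ runs (insert (Suc n) S))"
proof -
  let ?A = "{S. S \<subseteq> {1..<Suc n} \<and> card S = Suc j}"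
  let ?B = "{S. S \<subseteq> {1..<Suc n} \<and> card S = j}"
  have fin: "finite S" if "S \<subseteq> {1..<Suc n}" for S
    using that by (rule finite_subset) simp
  have eq: "{S. S \<subseteq> {1..<Suc (Suc n)} \<and> card S = Suc j} = ?A \<union> insert (Suc n) ` ?B"
  proof (intro set_eqI iffI)
    fix S assume S: "S \<in> {S. S \<subseteq> {1..<Suc (Suc n)} \<and> card S = Suc j}"
    show "S \<in> ?A \<union> insert (Suc n) ` ?B"
    proof (cases "Suc n \<in> S")
      case True
      then have "S = insert (Suc n) (S - {Suc n})" by blast
      moreover have "S - {Suc n} \<in> ?B" using S True by (auto simp: subset_iff less_Suc_eq)
      ultimately show ?thesis by blast
    next
      case False
      then show ?thesis using S by (auto simp: subset_iff less_Suc_eq)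
    qed
  next
    fix S assume S: "S \<in> ?A \<union> insert (Suc n) ` ?B"
    show "S \<in> {S. S \<subseteq> {1..<Suc (Suc n)} \<and> card S = Suc j}"
    proof (cases "S \<in> ?A")
      case True
      then show ?thesis by (auto simp: subset_iff less_Suc_eq)
    next
      case False
      then obtain T where T: "T \<in> ?B" "S = insert (Suc n) T" using S by blast
      have "Suc n \<notin> T" using T by auto
      then show ?thesis using T fin[of T] by (auto simp: subset_iff less_Suc_eq)
    qed
  qed
  have "inj_on (insert (Suc n)) ?B"
  proof (rule inj_onI)
    fix S T assume "S \<in> ?B" "T \<in> ?B" and eq: "insert (Suc n) S = insert (Suc n) T"
    then have "Suc n \<notin> S" "Suc n \<notin> T" by auto
    with eq show "S = T" by (simp add: insert_ident)
  qed
  moreover have "?A \<inter> insert (Suc n) ` ?B = {}" by auto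
  moreover have "finite ?A" "finite ?B" by auto
  ultimately show ?thesis
    unfolding run_sum_def eq by (subst sum.union_disjoint) (auto simp: sum.reindex)
qed

text \<open>In terms of \<open>n - j\<close> and \<open>j\<close> this is the Delannoy recurrence, which the coefficients of
  the powers of \<open>(1 + x) / (1 - x)\<close> satisfy too. The last pair of positions contributes a
  factor 2 unless it prolongs a run.\<close>
lemma run_sum_rec:
  "run_sum (Suc (Suc n)) (Suc j) = run_sum (Suc n) (Suc j) + run_sum (Suc n) j + run_sum n j"
proof -
  have "(\<Sum>S | S \<subseteq> {1..<Suc n} \<and> card S = j. (2::nat) ^ runs (insert (Suc n) S))
    = (\<Sum>S | S \<subseteq> {1..<Suc n} \<and> card S = j. 2 ^ runs S)
     + (\<Sum>S | S \<subseteq> {1..<n} \<and> card S = j. 2 ^ runs S)"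
  proof -
    have "(\<Sum>S | S \<subseteq> {1..<Suc n} \<and> card S = j. (2::nat) ^ runs (insert (Suc n) S))
      = (\<Sum>S | S \<subseteq> {1..<Suc n} \<and> card S = j. 2 ^ runs S + (if n \<notin> S then 2 ^ runs S else 0))"
      by (intro sum.cong) (auto simp: runs_insert)
    also have "\<dots> = (\<Sum>S | S \<subseteq> {1..<Suc n} \<and> card S = j. 2 ^ runs S)
      + (\<Sum>S | S \<in> {S. S \<subseteq> {1..<Suc n} \<and> card S = j} \<and> n \<notin> S. 2 ^ runs S)"
      unfolding sum.distrib by (subst sum.inter_filter) auto
    also have "{S. S \<in> {S. S \<subseteq> {1..<Suc n} \<and> card S = j} \<and> n \<notin> S} = {S. S \<subseteq> {1..<n} \<and> card S = j}"
      by (auto simp: less_Suc_eq subset_iff)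
    finally show ?thesis .
  qed
  then show ?thesis
    unfolding run_sum_split by (simp add: run_sum_def)
qed

section \<open>The generating function of adjacency-free permutations\<close>

text \<open>This is \<open>(1 - x) / (1 + x) = 1 - 2 x + 2 x^2 - \<dots>\<close>. Times \<open>x\<close>, it is the series
  of the ways to glue \<open>l\<close> entries into one, namely one way for \<open>l = 1\<close> and two ways,
  increasing and decreasing, for larger \<open>l\<close>, with the sign that inclusion-exclusion gives to
  \<open>l - 1\<close> prescribed adjacencies.\<close>
definition glue_fps :: "real fps" where
  "glue_fps = (1 - fps_X) * inverse (1 + fps_X)"

lemma glue_fps_mult: "(1 + fps_X) * glue_fps = 1 - fps_X"
proof -
  have "(1 + fps_X :: real fps) * inverse (1 + fps_X) = 1"
    by (rule inverse_mult_eq_1') simp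
  then show ?thesis
    unfolding glue_fps_def by (metis mult.left_commute mult.right_neutral)
qed

lemma glue_fps_power_rec:
  "fps_nth (glue_fps ^ Suc N) (Suc j)
     = fps_nth (glue_fps ^ N) (Suc j) - fps_nth (glue_fps ^ N) j - fps_nth (glue_fps ^ Suc N) j"
proof -
  have "(1 + fps_X) * glue_fps ^ Suc N = (1 - fps_X) * glue_fps ^ N"
    using glue_fps_mult by (metis mult.assoc power_Suc)
  then have "fps_nth ((1 + fps_X) * glue_fps ^ Suc N) (Suc j) = fps_nth ((1 - fps_X) * glue_fps ^ N) (Suc j)"
    by (simp only:)
  then show ?thesis
    by (simp add: ring_distribs del: power_Suc)
qed

lemma glue_fps_nth_0: "fps_nth glue_fps 0 = 1"
  by (simp add: glue_fps_def)

lemma glue_fps_power_0: "fps_nth (glue_fps ^ N) 0 = 1"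
  by (simp add: fps_power_zeroth glue_fps_nth_0)

text
  \<open>Both sides satisfy the same three-term recurrence; the signs of the inclusion-exclusion replace \<open>(1 + x) / (1 - x)\<close>
  by its value at \<open>-x\<close>.\<close>
lemma run_sum_eq_glue_fps:
  "j \<le> n \<Longrightarrow> (-1) ^ j * real (run_sum n j) = fps_nth (glue_fps ^ (n - j)) j"
proof (induction n arbitrary: j rule: induct_nat_012)
  case 0
  then show ?case by (simp add: run_sum_0)
next
  case 1
  then show ?case
    by (cases j) (simp_all add: run_sum_0 run_sum_eq_0 glue_fps_nth_0)
next
  case (ge2 n)
  show ?case
  proof (cases j)
    case 0
    then show ?thesis by (simp only: run_sum_0 glue_fps_power_0) simp
  next
    case (Suc k)
    show ?thesis
    proof (cases "k = Suc n")
      case True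
      then show ?thesis using Suc by (simp add: run_sum_eq_0)
    next
      case False
      then have k: "k \<le> n" using ge2.prems Suc by simp
      then have N: "Suc (Suc n) - j = Suc (n - k)" "Suc n - k = Suc (n - k)" "Suc n - Suc k = n - k"
        using Suc by auto
      show ?thesis
        unfolding N(1) unfolding Suc glue_fps_power_rec run_sum_rec
        using ge2.IH(1)[of k] ge2.IH(2)[of k] ge2.IH(2)[of "Suc k"] k N(2,3)
        by (simp add: algebra_simps del: power_Suc) (simp add: algebra_simps)
    qed
  qed
qed

definition adj_free_fps :: "real fps" where
  "adj_free_fps = Abs_fps fact oo (fps_X * glue_fps)"

text \<open>Collecting the inclusion-exclusion sum by the number \<open>r\<close> of entries that remain after
  gluing gives the terms \<open>r! y^r\<close> of the composition.\<close>
lemma adj_free_eq_fps_nth: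
  assumes "n > 0"
  shows "real (card (adj_free n)) = fps_nth adj_free_fps n"
proof -
  have "real (card (adj_free n)) = (\<Sum>j\<le>n. fps_nth (glue_fps ^ (n - j)) j * fact (n - j))"
    unfolding adj_free_eq_run_sum[OF assms] by (intro sum.cong) (auto simp: run_sum_eq_glue_fps)
  also have "\<dots> = (\<Sum>r\<le>n. fps_nth (glue_fps ^ r) (n - r) * fact r)"
    by (rule sum.reindex_bij_witness[of _ "\<lambda>r. n - r" "\<lambda>r. n - r"]) auto
  also have "\<dots> = fps_nth adj_free_fps n"
    unfolding adj_free_fps_def fps_compose_nth power_mult_distrib fps_X_power_mult_nth
    by (rule sum.cong) auto
  finally show ?thesis .
qed

text \<open>This is \<open>n! = (n - 1)! + (n - 1) (n - 1)!\<close>.\<close>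
lemma fact_fps_ode: "Abs_fps fact = 1 + fps_X * Abs_fps fact + fps_X ^ 2 * fps_deriv (Abs_fps (fact :: nat \<Rightarrow> real))"
proof (rule fps_ext)
  fix n
  show "fps_nth (Abs_fps fact) n = fps_nth (1 + fps_X * Abs_fps fact + fps_X ^ 2 * fps_deriv (Abs_fps (fact :: nat \<Rightarrow> real))) n"
  proof (cases n)
    case (Suc m)
    then show ?thesis
      by (cases m) (simp_all add: fps_X_power_mult_nth, simp add: algebra_simps)
  qed (simp add: fps_X_power_mult_nth)
qed

text \<open>Substitute \<open>y\<close> into the differential equation of the factorial series, multiply by
  \<open>y'\<close> so that the chain rule applies, and clear denominators by \<open>(1 + x)^3\<close>.\<close>
lemma adj_free_fps_ode:
  "(1 - 2 * fps_X - fps_X ^ 2) * (1 + fps_X) * (adj_free_fps - 1)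
    = (1 - 2 * fps_X - fps_X ^ 2) * (fps_X * (1 - fps_X)) * adj_free_fps
      + fps_X ^ 2 * (1 - fps_X) ^ 2 * (1 + fps_X) * fps_deriv adj_free_fps"
proof -
  define y where "y = fps_X * glue_fps"
  have y0: "fps_nth y 0 = 0" by (simp add: y_def)
  have y: "(1 + fps_X) * y = fps_X * (1 - fps_X)"
    unfolding y_def using glue_fps_mult by (metis mult.left_commute)
  have "fps_deriv ((1 + fps_X) * y) = fps_deriv (fps_X * (1 - fps_X))"
    by (simp add: y)
  then have "y + (1 + fps_X) * fps_deriv y = 1 - 2 * fps_X"
    by (simp add: algebra_simps)
  then have "(1 + fps_X) * y + (1 + fps_X) * ((1 + fps_X) * fps_deriv y) = (1 + fps_X) * (1 - 2 * fps_X)"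
    by (metis distrib_left)
  then have dy: "(1 + fps_X) ^ 2 * fps_deriv y = 1 - 2 * fps_X - fps_X ^ 2"
    unfolding y by (simp add: algebra_simps power2_eq_square)
  let ?F' = "fps_deriv (Abs_fps (fact :: nat \<Rightarrow> real)) oo y"
  have H: "adj_free_fps = 1 + y * adj_free_fps + y ^ 2 * ?F'"
    unfolding adj_free_fps_def y_def[symmetric]
    by (subst fact_fps_ode)
      (simp only: fps_compose_add_distrib fps_compose_mult_distrib[OF y0] fps_compose_1
         fps_compose_power[OF y0, symmetric] fps_X_fps_compose_startby0[OF y0])
  have D: "fps_deriv adj_free_fps = ?F' * fps_deriv y"
    unfolding adj_free_fps_def y_def[symmetric] by (rule fps_compose_deriv[OF y0])
  have "(1 + fps_X) * ((1 + fps_X) ^ 2 * fps_deriv y) * (adj_free_fps - 1)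
     = ((1 + fps_X) ^ 2 * fps_deriv y) * ((1 + fps_X) * y) * adj_free_fps
     + ((1 + fps_X) * y) ^ 2 * (1 + fps_X) * (?F' * fps_deriv y)"
    using H by algebra
  then show ?thesis
    unfolding dy y D[symmetric] by (simp add: power_mult_distrib mult.commute mult.left_commute)
qed

lemma adj_free_fps_rec:
  assumes "n \<ge> 4"
  shows "fps_nth adj_free_fps n = real (n + 1) * fps_nth adj_free_fps (n - 1)
    - (real n - 2) * fps_nth adj_free_fps (n - 2) - (real n - 5) * fps_nth adj_free_fps (n - 3)
    + (real n - 3) * fps_nth adj_free_fps (n - 4)"
proof -
  let ?H = adj_free_fps and ?X = "fps_X :: real fps"
  have "?H = (1 - ?X - 3 * ?X^2 - ?X ^ 3) + 2 * (?X * ?H) + 2 * (?X ^ 3 * ?H) + ?X ^ 4 * ?H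
    + ?X^2 * fps_deriv ?H - ?X ^ 3 * fps_deriv ?H - ?X ^ 4 * fps_deriv ?H + ?X ^ 5 * fps_deriv ?H"
    using adj_free_fps_ode by algebra
  then have *: "fps_nth ?H n = fps_nth ((1 - ?X - 3 * ?X^2 - ?X ^ 3) + 2 * (?X * ?H) + 2 * (?X ^ 3 * ?H) + ?X ^ 4 * ?H
    + ?X^2 * fps_deriv ?H - ?X ^ 3 * fps_deriv ?H - ?X ^ 4 * fps_deriv ?H + ?X ^ 5 * fps_deriv ?H) n"
    by simp
  obtain m where n: "n = m + 4" using assms by (metis add.commute le_Suc_ex)
  show ?thesis
    using * unfolding n
    by (cases m) (simp_all add: numeral_fps_const fps_X_power_mult_nth algebra_simps numeral_eq_Suc)
qed

section \<open>The proportion of adjacency-free permutations\<close>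

text \<open>There are at most as many runs as positions.\<close>
lemma run_sum_le: "run_sum n j \<le> 2 ^ j * (n choose j)"
proof -
  have "run_sum n j \<le> (\<Sum>S | S \<subseteq> {1..<n} \<and> card S = j. 2 ^ j)"
    unfolding run_sum_def
  proof (rule sum_mono)
    fix S assume S: "S \<in> {S. S \<subseteq> {1..<n} \<and> card S = j}"
    then have "finite S" using finite_subset[of S "{1..<n}"] by simp
    then show "2 ^ runs S \<le> (2::nat) ^ j"
      using runs_le_card[of S] S by (intro power_increasing) auto
  qed
  also have "\<dots> = 2 ^ j * ((n - 1) choose j)"
    by (simp add: n_subsets)
  also have "\<dots> \<le> 2 ^ j * (n choose j)"
    by (intro mult_le_mono2 binomial_right_mono) simp
  finally show ?thesis .
qed

text
  \<open>The binomial coefficient counts the sets without consecutive positions, in which every position is a run of its own. The induction on the recurrence bypasses that count.\<close>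
lemma run_sum_ge: "j \<le> n \<Longrightarrow> 2 ^ j * ((n - j) choose j) \<le> run_sum n j"
proof (induction n arbitrary: j rule: induct_nat_012)
  case 0
  then show ?case by (simp add: run_sum_0)
next
  case 1
  then show ?case by (cases j) (simp_all add: run_sum_0)
next
  case (ge2 n)
  show ?case
  proof (cases j)
    case 0
    then show ?thesis by (simp only: run_sum_0) simp
  next
    case (Suc k)
    show ?thesis
    proof (cases "k = Suc n")
      case False
      then have k: "k \<le> n" using ge2.prems Suc by simp
      have "2 ^ j * ((Suc (Suc n) - j) choose j) = 2 ^ Suc k * ((n - k) choose Suc k) + 2 * (2 ^ k * ((n - k) choose k))"
        using k Suc by (simp add: Suc_diff_le algebra_simps)
      also have "\<dots> \<le> run_sum (Suc n) (Suc k) + (run_sum (Suc n) k + run_sum n k)"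
      proof -
        have "2 ^ Suc k * ((n - k) choose Suc k) \<le> run_sum (Suc n) (Suc k)"
          using ge2.IH(2)[of "Suc k"] k by simp
        moreover have "2 ^ k * ((n - k) choose k) \<le> 2 ^ k * ((Suc n - k) choose k)"
          by (intro mult_le_mono2 binomial_right_mono) simp
        moreover have "2 ^ k * ((Suc n - k) choose k) \<le> run_sum (Suc n) k"
          using ge2.IH(2)[of k] k by simp
        ultimately show ?thesis using ge2.IH(1)[of k] k by linarith
      qed
      finally show ?thesis unfolding Suc run_sum_rec by simp
    qed (use Suc in simp)
  qed
qed

definition adj_free_ratio :: "nat \<Rightarrow> real" where
  "adj_free_ratio n = real (card (adj_free n)) / fact n"

lemma run_sum_ratio_le:
  assumes "j \<le> n"
  shows "real (run_sum n j) * fact (n - j) / fact n \<le> 2 ^ j / fact j"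
proof -
  have "real (run_sum n j) \<le> 2 ^ j * real (n choose j)"
    using run_sum_le[of n j] by (metis of_nat_le_iff of_nat_mult of_nat_numeral of_nat_power)
  then have "real (run_sum n j) * fact (n - j) / fact n \<le> 2 ^ j * real (n choose j) * fact (n - j) / fact n"
    by (intro divide_right_mono mult_right_mono) auto
  also have "\<dots> = 2 ^ j / fact j"
    by (simp add: binomial_fact[OF assms])
  finally show ?thesis .
qed

text \<open>The \<open>j\<close>-th factorial moment of the number of adjacencies, divided by \<open>j!\<close>, tends to
  that of the Poisson distribution with mean 2: prescribed adjacencies are typically far
  apart.\<close>
lemma run_sum_ratio_tendsto:
  "(\<lambda>n. real (run_sum n j) * fact (n - j) / fact n) \<longlonglongrightarrow> 2 ^ j / fact j"
proof (rule tendsto_sandwich)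
  show "\<forall>\<^sub>F n in sequentially. real (run_sum n j) * fact (n - j) / fact n \<le> 2 ^ j / fact j"
    using eventually_ge_at_top[of j] by eventually_elim (rule run_sum_ratio_le)
  let ?l = "\<lambda>n. 2 ^ j * (\<Prod>i = 0..<j. (real n - real j - real i) / real n / real (j - i))"
  show "\<forall>\<^sub>F n in sequentially. ?l n \<le> real (run_sum n j) * fact (n - j) / fact n"
    using eventually_ge_at_top[of "2 * j + 1"]
  proof eventually_elim
    case (elim n)
    have ch: "real ((n - j) choose j) = (\<Prod>i = 0..<j. real (n - j - i) / real (j - i))"
      using elim by (intro binomial_altdef_of_nat) auto
    have "?l n = 2 ^ j * real ((n - j) choose j) / real n ^ j"
    proof -
      have "(\<Prod>i = 0..<j. (real n - real j - real i) / real n / real (j - i))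
        = (\<Prod>i = 0..<j. real (n - j - i) / real (j - i) / real n)"
        using elim by (intro prod.cong refl) (simp add: of_nat_diff divide_divide_eq_left mult.commute)
      then show ?thesis unfolding ch by (simp add: prod_dividef prod.distrib)
    qed
    also have "\<dots> \<le> real (run_sum n j) / real n ^ j"
    proof -
      have "2 ^ j * real ((n - j) choose j) \<le> real (run_sum n j)"
        using run_sum_ge[of j n] elim
        by (metis (mono_tags, lifting) of_nat_le_iff of_nat_mult of_nat_numeral of_nat_power
            add_leD1 mult_2 trans_le_add1 le_trans)
      then show ?thesis by (intro divide_right_mono) auto
    qed
    also have "\<dots> \<le> real (run_sum n j) * (fact (n - j) / fact n)"
    proof -
      have "fact n div fact (n - j) \<le> n ^ j"
        using elim by (intro fact_div_fact_le_pow) simp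
      moreover have "fact (n - j) dvd (fact n :: nat)" by (intro fact_dvd) simp
      ultimately have "real (fact n) / real (fact (n - j)) \<le> real (n ^ j)"
        by (metis of_nat_le_iff real_of_nat_div)
      then have "1 / real n ^ j \<le> fact (n - j) / fact n"
        using elim by (simp add: field_simps)
      then show ?thesis
        using mult_left_mono[OF _ of_nat_0_le_iff[of "run_sum n j"]]
        by (metis mult.right_neutral times_divide_eq_right)
    qed
    finally show ?case by simp
  qed
  have "?l \<longlonglongrightarrow> 2 ^ j * (\<Prod>i = 0..<j. 1 / real (j - i))"
  proof (intro tendsto_mult tendsto_const tendsto_prod tendsto_divide)
    fix i assume "i \<in> {0..<j}"
    then show "real (j - i) \<noteq> 0" by simp
    have "(\<lambda>n. 1 - (real j + real i) / real n) \<longlonglongrightarrow> 1 - 0"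
      by (intro tendsto_diff tendsto_const lim_const_over_n)
    moreover have "\<forall>\<^sub>F n in sequentially. 1 - (real j + real i) / real n = (real n - real j - real i) / real n"
      using eventually_gt_at_top[of 0] by eventually_elim (simp add: field_simps)
    ultimately show "(\<lambda>n. (real n - real j - real i) / real n) \<longlonglongrightarrow> 1"
      by (simp add: tendsto_cong)
  qed
  moreover have prod: "(\<Prod>i = 0..<j. 1 / real (j - i)) = 1 / fact j"
    by (simp add: prod_dividef fact_prod_rev)
  ultimately show "?l \<longlonglongrightarrow> 2 ^ j / fact j"
    unfolding prod by (simp only: times_divide_eq_right mult_1_right)
qed simp

text \<open>Term by term the inclusion-exclusion sum tends to the series of \<open>exp (-2)\<close>, and the
  bounds \<open>2^k / k!\<close> make the series dominated.\<close>
lemma adj_free_ratio_tendsto: "adj_free_ratio \<longlonglongrightarrow> exp (-2)"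
proof -
  define a where "a k n = (if k \<le> n then (-1) ^ k * (real (run_sum n k) * fact (n - k) / fact n) else 0)" for k n
  have 1: "(\<lambda>n. a k n) \<longlonglongrightarrow> (-1) ^ k * (2 ^ k / fact k)" for k
  proof -
    have "(\<lambda>n. (-1) ^ k * (real (run_sum n k) * fact (n - k) / fact n)) \<longlonglongrightarrow> (-1) ^ k * (2 ^ k / fact k)"
      by (intro tendsto_mult tendsto_const run_sum_ratio_tendsto)
    moreover have "\<forall>\<^sub>F n in sequentially. (-1) ^ k * (real (run_sum n k) * fact (n - k) / fact n) = a k n"
      using eventually_ge_at_top[of k] by eventually_elim (simp add: a_def)
    ultimately show ?thesis by (rule Lim_transform_eventually)
  qed
  have "norm (a k n) \<le> 2 ^ k / fact k" for k n
    using run_sum_ratio_le[of k n] by (simp add: a_def abs_mult)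
  then have 2: "\<forall>\<^sub>F (k, n) in at_top \<times>\<^sub>F sequentially. norm (a k n) \<le> 2 ^ k / fact k"
    by (intro always_eventually) auto
  have 3: "summable (\<lambda>k. 2 ^ k / fact k :: real)"
    using summable_exp[of "2 :: real"] by (simp add: field_simps)
  have "(\<lambda>n. \<Sum>k. a k n) \<longlonglongrightarrow> (\<Sum>k. (-1) ^ k * (2 ^ k / fact k))"
    using tannerys_theorem[OF 1 2 3] by simp
  moreover have "(\<Sum>k. (-1) ^ k * (2 ^ k / fact k)) = exp (-2 :: real)"
    by (simp add: exp_def power_minus[of "2::real"] scaleR_conv_of_real divide_inverse mult.commute mult.left_commute)
  moreover have "\<forall>\<^sub>F n in sequentially. (\<Sum>k. a k n) = adj_free_ratio n"
    using eventually_gt_at_top[of 0]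
  proof eventually_elim
    case (elim n)
    have "(\<Sum>k. a k n) = (\<Sum>k\<le>n. a k n)"
      by (rule suminf_finite) (auto simp: a_def)
    also have "\<dots> = adj_free_ratio n"
      unfolding adj_free_ratio_def adj_free_eq_run_sum[OF elim] sum_divide_distrib
      by (intro sum.cong) (auto simp: a_def)
    finally show ?case .
  qed
  ultimately show ?thesis by (simp add: tendsto_cong)
qed

lemma adj_free_ratio_bounds: "0 \<le> adj_free_ratio n" "adj_free_ratio n \<le> 1"
proof -
  have "card (adj_free n) \<le> card (perms n)"
    unfolding adj_free_def by (intro card_mono) auto
  then have "real (card (adj_free n)) \<le> fact n"
    by (simp add: card_perms) (metis of_nat_fact of_nat_le_iff)
  then show "0 \<le> adj_free_ratio n" "adj_free_ratio n \<le> 1"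
    by (simp_all add: adj_free_ratio_def)
qed

text \<open>The coefficient recurrence, divided by \<open>n!\<close> and arranged by differences: because the
  coefficients nearly cancel, what is left besides the differences is only of order
  \<open>n^(-3)\<close>.\<close>
lemma adj_free_ratio_rec:
  fixes n :: nat
  assumes "n \<ge> 5"
  defines "h \<equiv> adj_free_ratio"
  shows "h n - h (n - 1) = (h (n - 1) - h (n - 2)) / real n
     + (h (n - 2) - h (n - 3)) / (real n * (real n - 1))
     + (3 * h (n - 3) + h (n - 4)) / (real n * (real n - 1) * (real n - 2))"
proof -
  obtain m where n: "n = m + 5" using assms by (metis add.commute le_Suc_ex)
  have eq: "fps_nth adj_free_fps k = h k * fact k" if "k > 0" for k
    unfolding h_def adj_free_ratio_def using adj_free_eq_fps_nth[OF that] by simp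
  have *: "h (m+5) * fact (m+5) = (real m + 6) * (h (m+4) * fact (m+4)) - (real m + 3) * (h (m+3) * fact (m+3))
     - real m * (h (m+2) * fact (m+2)) + (real m + 2) * (h (m+1) * fact (m+1))"
  proof -
    have idx: "m+5-1 = m+4" "m+5-2 = m+3" "m+5-3 = m+2" "m+5-4 = m+1"
      "real (m+5+1) = real m + 6" "real (m+5) - 2 = real m + 3" "real (m+5) - 5 = real m"
      "real (m+5) - 3 = real m + 2" by simp_all
    show ?thesis
      using adj_free_fps_rec[of "m+5"] eq[of "m+5"] eq[of "m+4"] eq[of "m+3"] eq[of "m+2"] eq[of "m+1"]
      unfolding idx by simp
  qed
  have f: "fact (m+2) = (real m + 2) * fact (m+1)" "fact (m+3) = (real m + 3) * ((real m + 2) * fact (m+1))"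
     "fact (m+4) = (real m + 4) * ((real m + 3) * ((real m + 2) * fact (m+1)))"
     "fact (m+5) = (real m + 5) * ((real m + 4) * ((real m + 3) * ((real m + 2) * fact (m+1))))"
    by (simp_all add: numeral_eq_Suc algebra_simps)
  have "fact (m+1) * (h (m+5) * ((real m + 5) * (real m + 4) * (real m + 3) * (real m + 2)))
     = fact (m+1) * ((real m + 6) * h (m+4) * (real m + 4) * (real m + 3) * (real m + 2)
       - (real m + 3) * h (m+3) * (real m + 3) * (real m + 2) - real m * h (m+2) * (real m + 2) + (real m + 2) * h (m+1))"
    using * unfolding f by (simp add: algebra_simps)
  then have "h (m+5) * ((real m + 5) * (real m + 4) * (real m + 3) * (real m + 2))
     = (real m + 6) * h (m+4) * (real m + 4) * (real m + 3) * (real m + 2)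
       - (real m + 3) * h (m+3) * (real m + 3) * (real m + 2) - real m * h (m+2) * (real m + 2) + (real m + 2) * h (m+1)"
    by simp
  then have "(real m + 2) * (h (m+5) * ((real m + 5) * (real m + 4) * (real m + 3)))
     = (real m + 2) * ((real m + 6) * h (m+4) * (real m + 4) * (real m + 3)
       - (real m + 3) * h (m+3) * (real m + 3) - real m * h (m+2) + h (m+1))"
    by (simp add: algebra_simps)
  then have "h (m+5) * ((real m + 5) * (real m + 4) * (real m + 3))
     = (real m + 6) * h (m+4) * (real m + 4) * (real m + 3)
       - (real m + 3) * h (m+3) * (real m + 3) - real m * h (m+2) + h (m+1)"
    by simp
  then have "(h (m+5) - h (m+4)) * ((real m + 5) * (real m + 4) * (real m + 3))
     = (h (m+4) - h (m+3)) * ((real m + 4) * (real m + 3)) + (h (m+3) - h (m+2)) * (real m + 3)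
       + (3 * h (m+2) + h (m+1))"
    by (simp add: algebra_simps)
  moreover have "(real m + 5) * (real m + 4) * (real m + 3) \<noteq> 0"
    by (simp add: add_nonneg_eq_0_iff)
  ultimately have "h (m+5) - h (m+4)
     = ((h (m+4) - h (m+3)) * ((real m + 4) * (real m + 3)) + (h (m+3) - h (m+2)) * (real m + 3)
       + (3 * h (m+2) + h (m+1))) / ((real m + 5) * (real m + 4) * (real m + 3))"
    by (subst nonzero_eq_divide_eq)
  also have "\<dots> = (h (m+4) - h (m+3)) / (real m + 5) + (h (m+3) - h (m+2)) / ((real m + 5) * (real m + 4))
       + (3 * h (m+2) + h (m+1)) / ((real m + 5) * (real m + 4) * (real m + 3))"
  proof -
    have "real m + 4 \<noteq> 0" "real m + 3 \<noteq> 0" by auto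
    then show ?thesis by (simp add: add_divide_distrib)
  qed
  finally have "h (m+5) - h (m+4) = \<dots>" .
  moreover have "m+5-1 = m+4" "m+5-2 = m+3" "m+5-3 = m+2" "m+5-4 = m+1"
    "real (m+5) = real m + 5" "real m + 5 - 1 = real m + 4" "real m + 5 - 2 = real m + 3"
    by simp_all
  ultimately show ?thesis unfolding n by metis
qed

lemma abs_divide_le:
  fixes a b c :: real
  shows "\<bar>a\<bar> \<le> b \<Longrightarrow> 0 < c \<Longrightarrow> \<bar>a / c\<bar> \<le> b / c"
  by (simp add: abs_divide divide_right_mono)

text \<open>Telescoping from \<open>n\<close> to infinity.\<close>
lemma tendsto_error_bound:
  fixes w g :: "nat \<Rightarrow> real"
  assumes lim: "w \<longlonglongrightarrow> L" "g \<longlonglongrightarrow> 0"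
    and step: "\<And>n. n \<ge> N \<Longrightarrow> \<bar>w (Suc n) - w n\<bar> \<le> g n - g (Suc n)"
    and "n \<ge> N"
  shows "\<bar>w n - L\<bar> \<le> g n"
proof -
  have *: "\<bar>w (n + k) - w n\<bar> \<le> g n - g (n + k)" for k
  proof (induction k)
    case (Suc k)
    then show ?case using step[of "n + k"] \<open>n \<ge> N\<close> by simp
  qed simp
  have l: "(\<lambda>k. w (n + k)) \<longlonglongrightarrow> L" "(\<lambda>k. g (n + k)) \<longlonglongrightarrow> 0"
    using lim[THEN LIMSEQ_ignore_initial_segment, of n] by (simp_all add: add.commute)
  have "\<bar>L - w n\<bar> \<le> g n - 0"
    by (rule LIMSEQ_le[OF tendsto_rabs[OF tendsto_diff[OF l(1) tendsto_const]] tendsto_diff[OF tendsto_const l(2)]])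
      (use * in blast)
  then show ?thesis by simp
qed

text \<open>Only the order \<open>n^(-3)\<close> matters. The constant 400 exceeds \<open>7^3\<close>, so that the trivial
  bound 1 suffices up to \<open>n = 7\<close>, and it leaves room for the induction step, which spends
  100, 100 and 200 on its three terms.\<close>
lemma adj_free_ratio_diff_bound:
  "n \<ge> 1 \<Longrightarrow> \<bar>adj_free_ratio n - adj_free_ratio (n - 1)\<bar> \<le> 400 / real n ^ 3"
proof (induction n rule: less_induct)
  case (less n)
  let ?h = adj_free_ratio
  have h: "0 \<le> ?h k" "?h k \<le> 1" for k by (rule adj_free_ratio_bounds)+
  show ?case
  proof (cases "n \<le> 7")
    case True
    have "real n ^ 3 \<le> 7 ^ 3" using True by (intro power_mono) auto
    then have "1 \<le> 400 / real n ^ 3" using less.prems by (simp add: field_simps)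
    moreover have "\<bar>?h n - ?h (n - 1)\<bar> \<le> 1" using h[of n] h[of "n-1"] by linarith
    ultimately show ?thesis by linarith
  next
    case False
    define x where "x = real n - 8"
    have x: "x \<ge> 0" "real n = x + 8" "real (n - 1) = x + 7" "real (n - 2) = x + 6"
      using False by (auto simp: x_def of_nat_diff)
    have "\<bar>?h n - ?h (n - 1)\<bar> \<le> \<bar>(?h (n - 1) - ?h (n - 2)) / real n\<bar>
       + \<bar>(?h (n - 2) - ?h (n - 3)) / (real n * (real n - 1))\<bar>
       + \<bar>(3 * ?h (n - 3) + ?h (n - 4)) / (real n * (real n - 1) * (real n - 2))\<bar>"
    proof -
      have "?h n - ?h (n - 1) = (?h (n - 1) - ?h (n - 2)) / real n
         + (?h (n - 2) - ?h (n - 3)) / (real n * (real n - 1))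
         + (3 * ?h (n - 3) + ?h (n - 4)) / (real n * (real n - 1) * (real n - 2))"
        using False by (intro adj_free_ratio_rec) auto
      then show ?thesis
        by (simp only: order.trans[OF abs_triangle_ineq add_right_mono[OF abs_triangle_ineq]])
    qed
    also have "\<dots> \<le> (400 / real (n - 1) ^ 3) / real n + (400 / real (n - 2) ^ 3) / (real n * (real n - 1))
       + 4 / (real n * (real n - 1) * (real n - 2))"
    proof (intro add_mono)
      show "\<bar>(?h (n - 1) - ?h (n - 2)) / real n\<bar> \<le> (400 / real (n - 1) ^ 3) / real n"
        using less.IH[of "n - 1"] False by (intro abs_divide_le) (auto simp: numeral_2_eq_2)
      show "\<bar>(?h (n - 2) - ?h (n - 3)) / (real n * (real n - 1))\<bar> \<le> (400 / real (n - 2) ^ 3) / (real n * (real n - 1))"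
        using less.IH[of "n - 2"] False x by (intro abs_divide_le) (auto simp: numeral_3_eq_3 numeral_2_eq_2)
      show "\<bar>(3 * ?h (n - 3) + ?h (n - 4)) / (real n * (real n - 1) * (real n - 2))\<bar>
          \<le> 4 / (real n * (real n - 1) * (real n - 2))"
        using h[of "n-3"] h[of "n-4"] x by (intro abs_divide_le) auto
    qed
    also have "\<dots> \<le> 400 / real n ^ 3"
    proof -
      have "(400 / (x + 7) ^ 3) / (x + 8) \<le> 100 / (x + 8) ^ 3"
      proof -
        have "4 * (x + 8) ^ 2 \<le> (x + 7) ^ 3"
          using x(1) by (simp add: algebra_simps power2_eq_square power3_eq_cube mult_nonneg_nonneg)
        then have "400 * (x + 8) ^ 2 * (x + 8) \<le> 100 * (x + 7) ^ 3 * (x + 8)"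
          using x(1) by (intro mult_right_mono) auto
        then show ?thesis using x(1) by (simp add: divide_simps power3_eq_cube power2_eq_square mult_ac)
      qed
      moreover have "(400 / (x + 6) ^ 3) / ((x + 8) * (x + 7)) \<le> 100 / (x + 8) ^ 3"
      proof -
        have "4 * (x + 8) ^ 2 \<le> (x + 7) * (x + 6) ^ 3"
          using x(1) by (simp add: algebra_simps power2_eq_square power3_eq_cube mult_nonneg_nonneg add_nonneg_nonneg)
        then have "400 * (x + 8) ^ 2 * (x + 8) \<le> 100 * ((x + 7) * (x + 6) ^ 3) * (x + 8)"
          using x(1) by (intro mult_right_mono) auto
        then show ?thesis using x(1) by (simp add: divide_simps power3_eq_cube power2_eq_square mult_ac)
      qed
      moreover have "4 / ((x + 8) * (x + 7) * (x + 6)) \<le> 200 / (x + 8) ^ 3"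
      proof -
        have "(x + 8) ^ 2 \<le> 50 * ((x + 6) * (x + 7))"
          using x(1) by (simp add: algebra_simps power2_eq_square mult_nonneg_nonneg)
        then have "4 * (x + 8) ^ 2 * (x + 8) \<le> 200 * ((x + 6) * (x + 7)) * (x + 8)"
          using x(1) by (intro mult_right_mono) auto
        then show ?thesis using x(1) by (simp add: divide_simps power3_eq_cube power2_eq_square mult_ac)
      qed
      moreover have "real n - 1 = x + 7" "real n - 2 = x + 6" using x(2) by auto
      ultimately show ?thesis unfolding x(2-4) by (simp add: field_simps)
    qed
    finally show ?thesis .
  qed
qed

lemma adj_free_ratio_error:
  assumes "n \<ge> 1"
  shows "\<bar>adj_free_ratio n - exp (-2)\<bar> \<le> 400 / real n ^ 2"
proof (rule tendsto_error_bound[OF adj_free_ratio_tendsto _ _ assms])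
  show "(\<lambda>n. 400 / real n ^ 2) \<longlonglongrightarrow> 0" by real_asymp
next
  fix n :: nat assume n: "1 \<le> n"
  define x where "x = real n"
  have x: "x \<ge> 1" using n by (simp add: x_def)
  have "\<bar>adj_free_ratio (Suc n) - adj_free_ratio n\<bar> \<le> 400 / (x + 1) ^ 3"
    using adj_free_ratio_diff_bound[of "Suc n"] by (simp add: x_def add.commute)
  also have "\<dots> \<le> 400 * ((2 * x + 1) / (x ^ 2 * (x + 1) ^ 2))"
  proof -
    have "x ^ 2 \<le> (2 * x + 1) * (x + 1)" using x by (simp add: algebra_simps power2_eq_square)
    then have "1 / (x + 1) ^ 3 \<le> (2 * x + 1) / (x ^ 2 * (x + 1) ^ 2)"
      using x by (simp add: divide_simps power2_eq_square power3_eq_cube)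
    then have "400 * (1 / (x + 1) ^ 3) \<le> 400 * ((2 * x + 1) / (x ^ 2 * (x + 1) ^ 2))"
      by (rule mult_left_mono) simp
    then show ?thesis by (simp only: times_divide_eq_right mult_1_right)
  qed
  also have "\<dots> = 400 / real n ^ 2 - 400 / real (Suc n) ^ 2"
  proof -
    have "2 * x + 1 = (1 + x) ^ 2 * 1 - 1 * x ^ 2" by (simp add: power2_eq_square algebra_simps)
    then have "(2 * x + 1) / (x ^ 2 * (1 + x) ^ 2) = 1 / x ^ 2 - 1 / (1 + x) ^ 2"
      using x by (subst diff_frac_eq) (auto simp: mult.commute)
    then have "400 * ((2 * x + 1) / (x ^ 2 * (1 + x) ^ 2)) = 400 * (1 / x ^ 2) - 400 * (1 / (1 + x) ^ 2)"
      by (simp only: right_diff_distrib)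
    then show ?thesis unfolding x_def[symmetric] of_nat_Suc by (simp add: add.commute)
  qed
  finally show "\<bar>adj_free_ratio (Suc n) - adj_free_ratio n\<bar> \<le> 400 / real n ^ 2 - 400 / real (Suc n) ^ 2" .
qed

text \<open>The differences are \<open>4 exp (-2) / n^3\<close> up to \<open>O(n^(-4))\<close>, and \<open>2 exp (-2) / n^2\<close> has
  the opposite differences to the same accuracy; so their sum \<open>w\<close> converges at the rate
  \<open>n^(-3)\<close>.\<close>
lemma adj_free_ratio_expansion:
  "(\<lambda>n. adj_free_ratio n - exp (-2) * (1 - 2 / real n ^ 2)) \<in> O(\<lambda>n. 1 / real n ^ 3)"
proof -
  let ?h = adj_free_ratio and ?L = "exp (-2) :: real"
  define w where "w n = ?h n + 2 * ?L / real n ^ 2" for n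
  (* B bounds the differences of w, term by term along the recurrence. *)
  define B :: "nat \<Rightarrow> real" where "B n = 400 / (real n - 1) ^ 3 / real n + 400 / (real n - 2) ^ 3 / (real n * (real n - 1))
     + (3 * (400 / (real n - 3) ^ 2) + 400 / (real n - 4) ^ 2) / (real n * (real n - 1) * (real n - 2))
     + \<bar>4 * ?L / (real n * (real n - 1) * (real n - 2)) + 2 * ?L / real n ^ 2 - 2 * ?L / (real n - 1) ^ 2\<bar>" for n
  have step: "\<bar>w n - w (n - 1)\<bar> \<le> B n" if n: "n \<ge> 8" for n
  proof -
    have r: "real (n - 1) = real n - 1" "real (n - 2) = real n - 2" "real (n - 3) = real n - 3"
      "real (n - 4) = real n - 4" using n by (auto simp: of_nat_diff)
    have "w n - w (n - 1) = (?h n - ?h (n - 1)) + 2 * ?L / real n ^ 2 - 2 * ?L / (real n - 1) ^ 2"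
      unfolding w_def r by simp
    also have "\<dots> = (?h (n - 1) - ?h (n - 2)) / real n + (?h (n - 2) - ?h (n - 3)) / (real n * (real n - 1))
      + (3 * (?h (n - 3) - ?L) + (?h (n - 4) - ?L)) / (real n * (real n - 1) * (real n - 2))
      + (4 * ?L / (real n * (real n - 1) * (real n - 2)) + 2 * ?L / real n ^ 2 - 2 * ?L / (real n - 1) ^ 2)"
      using n by (subst adj_free_ratio_rec) (auto simp: add_divide_distrib diff_divide_distrib algebra_simps)
    finally have "\<bar>w n - w (n - 1)\<bar> = \<bar>\<dots>\<bar>" by simp
    also have "\<dots> \<le> \<bar>(?h (n - 1) - ?h (n - 2)) / real n\<bar> + \<bar>(?h (n - 2) - ?h (n - 3)) / (real n * (real n - 1))\<bar>
      + \<bar>(3 * (?h (n - 3) - ?L) + (?h (n - 4) - ?L)) / (real n * (real n - 1) * (real n - 2))\<bar>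
      + \<bar>4 * ?L / (real n * (real n - 1) * (real n - 2)) + 2 * ?L / real n ^ 2 - 2 * ?L / (real n - 1) ^ 2\<bar>"
      by (intro order.trans[OF abs_triangle_ineq] add_mono order.refl)
    also have "\<dots> \<le> B n"
      unfolding B_def
    proof (intro add_mono order.refl)
      show "\<bar>(?h (n - 1) - ?h (n - 2)) / real n\<bar> \<le> 400 / (real n - 1) ^ 3 / real n"
        using adj_free_ratio_diff_bound[of "n - 1"] n unfolding r(1)
        by (intro abs_divide_le) (auto simp: numeral_2_eq_2)
      show "\<bar>(?h (n - 2) - ?h (n - 3)) / (real n * (real n - 1))\<bar> \<le> 400 / (real n - 2) ^ 3 / (real n * (real n - 1))"
        using adj_free_ratio_diff_bound[of "n - 2"] n unfolding r(2)
        by (intro abs_divide_le) (auto simp: numeral_3_eq_3 numeral_2_eq_2)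
      have "\<bar>3 * (?h (n - 3) - ?L) + (?h (n - 4) - ?L)\<bar> \<le> 3 * (400 / (real n - 3) ^ 2) + 400 / (real n - 4) ^ 2"
      proof -
        have "\<bar>?h (n - 3) - ?L\<bar> \<le> 400 / (real n - 3) ^ 2" "\<bar>?h (n - 4) - ?L\<bar> \<le> 400 / (real n - 4) ^ 2"
          using adj_free_ratio_error[of "n - 3"] adj_free_ratio_error[of "n - 4"] n unfolding r by auto
        moreover have "\<bar>3 * a + b\<bar> \<le> 3 * c + d" if "\<bar>a\<bar> \<le> c" "\<bar>b\<bar> \<le> d" for a b c d :: real
          using that by linarith
        ultimately show ?thesis by blast
      qed
      then show "\<bar>(3 * (?h (n - 3) - ?L) + (?h (n - 4) - ?L)) / (real n * (real n - 1) * (real n - 2))\<bar>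
         \<le> (3 * (400 / (real n - 3) ^ 2) + 400 / (real n - 4) ^ 2) / (real n * (real n - 1) * (real n - 2))"
        using n by (intro abs_divide_le) auto
    qed
    finally show ?thesis .
  qed
  have "B \<in> O(\<lambda>n. 1 / real n ^ 4)"
    unfolding B_def by real_asymp
  then obtain C where C: "C > 0" "\<forall>\<^sub>F n in sequentially. norm (B n) \<le> C * norm (1 / real n ^ 4)"
    by (auto elim: landau_o.bigE)
  from C(2) obtain M where M: "\<And>n. n \<ge> M \<Longrightarrow> \<bar>B n\<bar> \<le> C / real n ^ 4"
    by (auto simp: eventually_at_top_linorder)
  have lim: "w \<longlonglongrightarrow> ?L"
  proof -
    have "(\<lambda>n. 2 * ?L / real n ^ 2) \<longlonglongrightarrow> 0" by real_asymp
    from tendsto_add[OF adj_free_ratio_tendsto this] show ?thesis by (simp add: w_def[abs_def])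
  qed
  have bound: "\<bar>w n - ?L\<bar> \<le> C / real n ^ 3" if n: "n \<ge> max M 8" for n
  proof (rule tendsto_error_bound[OF lim _ _ n])
    show "(\<lambda>n. C / real n ^ 3) \<longlonglongrightarrow> 0" using C(1) by real_asymp
  next
    fix n assume n: "max M 8 \<le> n"
    define x where "x = real n"
    have x: "x \<ge> 8" using n by (simp add: x_def)
    have "\<bar>w (Suc n) - w n\<bar> \<le> B (Suc n)" using step[of "Suc n"] n by simp
    also have "\<dots> \<le> C / (x + 1) ^ 4" using M[of "Suc n"] n by (simp add: x_def add.commute)
    also have "\<dots> \<le> C * (1 / x ^ 3 - 1 / (x + 1) ^ 3)"
    proof -
      have "1 / (x + 1) ^ 4 \<le> (3 * x ^ 2 + 3 * x + 1) / (x ^ 3 * (x + 1) ^ 3)"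
      proof -
        have "x ^ 3 \<le> (3 * x ^ 2 + 3 * x + 1) * (x + 1)"
          using x by (simp add: algebra_simps power2_eq_square power3_eq_cube)
        then have "x ^ 3 * (x + 1) ^ 3 \<le> (3 * x ^ 2 + 3 * x + 1) * (x + 1) * (x + 1) ^ 3"
          using x by (intro mult_right_mono) auto
        also have "\<dots> = (3 * x ^ 2 + 3 * x + 1) * (x + 1) ^ 4"
          by (simp add: numeral_eq_Suc)
        finally show ?thesis using x by (simp add: divide_simps)
      qed
      also have "\<dots> = 1 / x ^ 3 - 1 / (x + 1) ^ 3"
      proof -
        have "3 * x ^ 2 + 3 * x + 1 = (x + 1) ^ 3 * 1 - 1 * x ^ 3"
          by (simp add: power2_eq_square power3_eq_cube algebra_simps)
        then show ?thesis using x by (subst diff_frac_eq) (auto simp: mult.commute)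
      qed
      finally show ?thesis using C(1) by (simp add: mult_left_mono divide_inverse)
    qed
    finally show "\<bar>w (Suc n) - w n\<bar> \<le> C / real n ^ 3 - C / real (Suc n) ^ 3"
      by (simp add: x_def algebra_simps)
  qed
  show ?thesis
  proof (rule bigoI[of _ C])
    show "\<forall>\<^sub>F n in sequentially. norm (?h n - ?L * (1 - 2 / real n ^ 2)) \<le> C * norm (1 / real n ^ 3)"
      using eventually_ge_at_top[of "max M 8"]
      by eventually_elim (use bound in \<open>auto simp: w_def algebra_simps\<close>)
  qed
qed

section \<open>Corners\<close>

lemma perms_Suc_fixed: "p \<in> perms (Suc n) \<and> p (Suc n) = Suc n \<longleftrightarrow> p \<in> perms n"
proof
  assume p: "p \<in> perms (Suc n) \<and> p (Suc n) = Suc n"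
  then have p': "p \<in> perms (Suc n)" by simp
  show "p \<in> perms n"
  proof (rule permsI)
    show "p i \<in> {1..n}" if "i \<in> {1..n}" for i
      using perms_range[OF p', of i] perms_inj[OF p', of i "Suc n"] p that
      by (cases "p i = Suc n") auto
    show "inj_on p {1..n}" by (rule inj_onI) (rule perms_inj[OF p'])
    show "p i = i" if "i \<notin> {1..n}" for i
      using perms_outside[OF p', of i] p that by (cases "i = Suc n") auto
  qed
next
  assume p: "p \<in> perms n"
  show "p \<in> perms (Suc n) \<and> p (Suc n) = Suc n"
    using p permutes_subset[of p "{1..n}" "{1..Suc n}"] perms_outside[OF p, of "Suc n"]
    by (auto simp: perms_def)
qed

text \<open>Deleting the corner \<open>p (n + 1) = n + 1\<close> leaves the function unchanged, by the
  convention that a permutation fixes everything outside its domain.\<close>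
lemma adj_free_Suc_fixed:
  assumes "n \<ge> 1"
  shows "p \<in> adj_free (Suc n) \<and> p (Suc n) = Suc n \<longleftrightarrow> p \<in> adj_free n \<and> p n \<noteq> n"
proof -
  have "(\<forall>i\<in>{1..<Suc n}. \<not> adj p i) \<longleftrightarrow> (\<forall>i\<in>{1..<n}. \<not> adj p i) \<and> \<not> adj p n"
    using assms by (auto simp: less_Suc_eq)
  moreover have "adj p n \<longleftrightarrow> p n = n" if "p \<in> perms n" "p (Suc n) = Suc n"
    using perms_range[OF that(1), of n] assms that(2) by (auto simp: adj_def)
  ultimately show ?thesis
    using perms_Suc_fixed[of p n] by (auto simp: adj_free_def)
qed

definition reversal :: "nat \<Rightarrow> nat \<Rightarrow> nat" where
  "reversal n i = (if i \<in> {1..n} then Suc n - i else i)"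

lemma reversal_reversal: "reversal n (reversal n i) = i"
  by (auto simp: reversal_def)

lemma reversal_perms: "reversal n \<in> perms n"
  by (rule permsI) (auto simp: reversal_def inj_on_def)

lemma perms_comp: "p \<in> perms n \<Longrightarrow> q \<in> perms n \<Longrightarrow> p \<circ> q \<in> perms n"
  by (simp add: perms_def permutes_compose)

lemma reversal_comp_adj_free:
  assumes "p \<in> adj_free n"
  shows "reversal n \<circ> p \<in> adj_free n"
proof -
  have p: "p \<in> perms n" using assms by (simp add: adj_free_def)
  have "adj (reversal n \<circ> p) i \<longleftrightarrow> adj p i" if "i \<in> {1..<n}" for i
    using perms_range[OF p, of i] perms_range[OF p, of "Suc i"] that
    by (auto simp: adj_def reversal_def)
  then show ?thesis
    using assms perms_comp[OF reversal_perms p] by (auto simp: adj_free_def)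
qed

lemma comp_reversal_adj_free:
  assumes "p \<in> adj_free n"
  shows "p \<circ> reversal n \<in> adj_free n"
proof -
  have p: "p \<in> perms n" using assms by (simp add: adj_free_def)
  have "adj (p \<circ> reversal n) i \<longleftrightarrow> adj p (n - i)" if "i \<in> {1..<n}" for i
    using that by (auto simp: adj_def reversal_def Suc_diff_le)
  moreover have "n - i \<in> {1..<n}" if "i \<in> {1..<n}" for i using that by auto
  ultimately show ?thesis
    using assms perms_comp[OF p reversal_perms] by (auto simp: adj_free_def)
qed

lemma card_adj_free_reverse_values:
  "card {p \<in> adj_free n. P (reversal n \<circ> p)} = card {p \<in> adj_free n. P p}"
proof -
  have [simp]: "reversal n \<circ> (reversal n \<circ> p) = p" for p by (auto simp: reversal_reversal)
  show ?thesis
    by (rule bij_betw_same_card[of "\<lambda>p. reversal n \<circ> p"], rule bij_betw_byWitness[of _ "\<lambda>p. reversal n \<circ> p"])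
      (auto simp: reversal_comp_adj_free)
qed

lemma card_adj_free_reverse_positions:
  "card {p \<in> adj_free n. P (p \<circ> reversal n)} = card {p \<in> adj_free n. P p}"
proof -
  have [simp]: "(p \<circ> reversal n) \<circ> reversal n = p" for p by (auto simp: reversal_reversal)
  show ?thesis
    by (rule bij_betw_same_card[of "\<lambda>p. p \<circ> reversal n"], rule bij_betw_byWitness[of _ "\<lambda>p. p \<circ> reversal n"])
      (auto simp: comp_reversal_adj_free)
qed

definition corner_count :: "nat \<Rightarrow> nat" where
  "corner_count n = card {p \<in> adj_free n. p n = n}"

definition opposite_corners_count :: "nat \<Rightarrow> nat" where
  "opposite_corners_count n = card {p \<in> adj_free n. p n = n \<and> p 1 = 1}"

lemma corner_count_first_last:
  assumes "n \<ge> 1"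
  shows "card {p \<in> adj_free n. p n = 1} = corner_count n"
    and "card {p \<in> adj_free n. p 1 = n} = corner_count n"
    and "card {p \<in> adj_free n. p 1 = 1} = corner_count n"
    and "card {p \<in> adj_free n. p 1 = n \<and> p n = 1} = opposite_corners_count n"
proof -
  have *: "reversal n (p i) = n \<longleftrightarrow> p i = 1" "reversal n (p i) = 1 \<longleftrightarrow> p i = n" if "p \<in> adj_free n" "i \<in> {1, n}" for p i
    using perms_range[of p n i] that assms by (auto simp: adj_free_def reversal_def)
  have f: "reversal n n = 1" "reversal n 1 = n" using assms by (auto simp: reversal_def)
  have "{p \<in> adj_free n. p n = 1} = {p \<in> adj_free n. (reversal n \<circ> p) n = n}"
    using * by auto
  then show 1: "card {p \<in> adj_free n. p n = 1} = corner_count n"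
    unfolding corner_count_def using card_adj_free_reverse_values[of n "\<lambda>p. p n = n"] by simp
  show "card {p \<in> adj_free n. p 1 = n} = corner_count n"
    unfolding corner_count_def using card_adj_free_reverse_positions[of n "\<lambda>p. p 1 = n"] f by simp
  show "card {p \<in> adj_free n. p 1 = 1} = corner_count n"
    using 1 card_adj_free_reverse_positions[of n "\<lambda>p. p 1 = 1"] f by simp
  have "{p \<in> adj_free n. p 1 = n \<and> p n = 1} = {p \<in> adj_free n. (reversal n \<circ> p) n = n \<and> (reversal n \<circ> p) 1 = 1}"
    using * by auto
  then show "card {p \<in> adj_free n. p 1 = n \<and> p n = 1} = opposite_corners_count n"
    unfolding opposite_corners_count_def using card_adj_free_reverse_values[of n "\<lambda>p. p n = n \<and> p 1 = 1"] by simp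
qed

lemma corner_count_Suc:
  assumes "n \<ge> 1"
  shows "corner_count (Suc n) + corner_count n = card (adj_free n)"
proof -
  have "{p \<in> adj_free (Suc n). p (Suc n) = Suc n} = {p \<in> adj_free n. p n \<noteq> n}"
    using adj_free_Suc_fixed[OF assms] by blast
  moreover have "card {p \<in> adj_free n. p n \<noteq> n} + card {p \<in> adj_free n. p n = n} = card (adj_free n)"
    by (subst card_Un_disjoint[symmetric]) (auto intro!: arg_cong[of _ _ card])
  ultimately show ?thesis by (simp add: corner_count_def)
qed

lemma opposite_corners_count_Suc:
  assumes "n \<ge> 1"
  shows "opposite_corners_count (Suc n) + opposite_corners_count n = corner_count n"
proof -
  have "{p \<in> adj_free (Suc n). p (Suc n) = Suc n \<and> p 1 = 1} = {p \<in> adj_free n. p n \<noteq> n \<and> p 1 = 1}"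
    using adj_free_Suc_fixed[OF assms] by blast
  moreover have "card {p \<in> adj_free n. p n \<noteq> n \<and> p 1 = 1} + card {p \<in> adj_free n. p n = n \<and> p 1 = 1}
      = card {p \<in> adj_free n. p 1 = 1}"
    by (subst card_Un_disjoint[symmetric]) (auto intro!: arg_cong[of _ _ card])
  ultimately show ?thesis
    using corner_count_first_last(3)[OF assms] by (simp add: opposite_corners_count_def)
qed

definition corner_free :: "nat \<Rightarrow> (nat \<Rightarrow> nat) set" where
  "corner_free n = {p \<in> adj_free n. p 1 \<notin> {1, n} \<and> p n \<notin> {1, n}}"

text
  \<open>Corners are values at two different positions, so a permutation has at most two of them, and two only if they are opposite; there are two opposite pairs.\<close>
lemma card_corner_free:
  assumes "n \<ge> 2"
  shows "card (corner_free n) + 4 * corner_count n = card (adj_free n) + 2 * opposite_corners_count n"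
proof -
  let ?K = "\<lambda>i v. {p \<in> adj_free n. p i = v}"
  have inj: "i = j" if "p \<in> adj_free n" "p i = p j" for p i j
    using that perms_inj[of p n i j] by (simp add: adj_free_def)
  have n1: "n \<noteq> 1" using assms by simp
  have fin: "finite (?K i v)" for i v by simp
  have two: "card (A \<union> B) + card (A \<inter> B) = card A + card B" if "finite A" "finite B" for A B :: "(nat \<Rightarrow> nat) set"
    using card_Un_Int[OF that] by simp
  have "?K n n \<inter> ?K 1 1 = {p \<in> adj_free n. p n = n \<and> p 1 = 1}" by blast
  then have 1: "card (?K n n \<union> ?K 1 1) + opposite_corners_count n = 2 * corner_count n"
    using two[OF fin fin, of n n 1 1] corner_count_first_last(3) assms
    by (simp add: opposite_corners_count_def corner_count_def)
  have "?K 1 n \<inter> ?K n 1 = {p \<in> adj_free n. p 1 = n \<and> p n = 1}" by blast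
  then have 2: "card (?K 1 n \<union> ?K n 1) + opposite_corners_count n = 2 * corner_count n"
    using two[OF fin fin, of 1 n n 1] corner_count_first_last(1,2,4) assms
    by simp
  have "(?K n n \<union> ?K 1 1) \<inter> (?K 1 n \<union> ?K n 1) = {}"
    using inj n1 by auto
  then have "card ((?K n n \<union> ?K 1 1) \<union> (?K 1 n \<union> ?K n 1)) = card (?K n n \<union> ?K 1 1) + card (?K 1 n \<union> ?K n 1)"
    by (intro card_Un_disjoint) auto
  moreover have "adj_free n = corner_free n \<union> ((?K n n \<union> ?K 1 1) \<union> (?K 1 n \<union> ?K n 1))"
    by (auto simp: corner_free_def)
  moreover have "card (corner_free n \<union> ((?K n n \<union> ?K 1 1) \<union> (?K 1 n \<union> ?K n 1)))
      = card (corner_free n) + card ((?K n n \<union> ?K 1 1) \<union> (?K 1 n \<union> ?K n 1))"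
    by (intro card_Un_disjoint) (auto simp: corner_free_def)
  ultimately have "card (adj_free n) = card (corner_free n) + (card (?K n n \<union> ?K 1 1) + card (?K 1 n \<union> ?K n 1))"
    by metis
  then show ?thesis using 1 2 by linarith
qed

lemma card_adj_free_le: "card (adj_free n) \<le> fact n"
  using card_mono[of "perms n" "adj_free n"] by (auto simp: adj_free_def card_perms)

text \<open>Iterating the corner recurrences, \<open>corner_count n\<close> is \<open>H (n - 1) - H (n - 2)\<close> and
  \<open>opposite_corners_count n\<close> is \<open>H (n - 2)\<close>, each up to \<open>O((n - 3)!)\<close>, where \<open>H\<close> counts
  adjacency-free permutations.\<close>
lemma card_corner_free_expansion:
  assumes "n \<ge> 4"
  shows "\<bar>real (card (corner_free n)) - (real (card (adj_free n)) - 4 * real (card (adj_free (n - 1)))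
      + 6 * real (card (adj_free (n - 2))))\<bar> \<le> 8 * fact (n - 3)"
proof -
  obtain m where n: "n = m + 4" using assms by (metis add.commute le_Suc_ex)
  have s: "Suc (m+1) = m+2" "Suc (m+2) = m+3" "Suc (m+3) = m+4" by simp_all
  have C: "corner_count (m+4) + corner_count (m+3) = card (adj_free (m+3))"
    "corner_count (m+3) + corner_count (m+2) = card (adj_free (m+2))"
    "corner_count (m+2) + corner_count (m+1) = card (adj_free (m+1))"
    using corner_count_Suc[of "m+3"] corner_count_Suc[of "m+2"] corner_count_Suc[of "m+1"]
    unfolding s by simp_all
  have D: "opposite_corners_count (m+4) + opposite_corners_count (m+3) = corner_count (m+3)"
    "opposite_corners_count (m+3) + opposite_corners_count (m+2) = corner_count (m+2)"
    using opposite_corners_count_Suc[of "m+3"] opposite_corners_count_Suc[of "m+2"] unfolding s by simp_all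
  have "corner_count (m+2) \<le> fact (m+1)"
    using C(3) card_adj_free_le[of "m+1"] by linarith
  then have f: "real (corner_count (m+2)) \<le> fact (m+1)"
    by (metis of_nat_fact of_nat_le_iff)
  have "card (corner_free (m+4)) + 4 * corner_count (m+4) = card (adj_free (m+4)) + 2 * opposite_corners_count (m+4)"
    by (rule card_corner_free) simp
  then have "real (card (corner_free (m+4))) - (real (card (adj_free (m+4))) - 4 * real (card (adj_free (m+3)))
      + 6 * real (card (adj_free (m+2)))) = - 6 * real (corner_count (m+2)) - 2 * real (opposite_corners_count (m+3))"
    using C(1,2) D(1) by linarith
  moreover have "real (opposite_corners_count (m+3)) \<le> real (corner_count (m+2))"
    using D(2) by linarith
  moreover have idx: "m+4-1 = m+3" "m+4-2 = m+2" "m+4-3 = m+1" by simp_all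
  ultimately show ?thesis unfolding n idx using f by linarith
qed

section \<open>Inflating a point to a simple block of length four\<close>

text
  \<open>The two simple permutations of length four, 2413 and 3142, with positions and values counted from 0.\<close>
definition simple4 :: "bool \<Rightarrow> nat \<Rightarrow> nat" where
  "simple4 b t = (if b then (if t = 0 then 1 else if t = 1 then 3 else if t = 2 then 0 else 2)
     else (if t = 0 then 2 else if t = 1 then 0 else if t = 2 then 3 else 1))"

text \<open>Shrinks the interval from \<open>a\<close> to \<open>a + 3\<close> to the point \<open>a\<close>.\<close>
definition squeeze :: "nat \<Rightarrow> nat \<Rightarrow> nat" where
  "squeeze a i = (if i \<le> a then i else if i \<le> a + 3 then a else i - 3)"

text \<open>A section of \<open>squeeze a\<close>, with \<open>a\<close> itself as the representative of the interval.\<close>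
definition stretch :: "nat \<Rightarrow> nat \<Rightarrow> nat" where
  "stretch a i = (if i \<le> a then i else i + 3)"

text \<open>The inflation of the entry at position \<open>a\<close>, in the sense of the substitution
  decomposition. Beyond the domain the two shifts by 3 cancel, which makes the inflation the
  identity there.\<close>
definition inflate :: "nat \<Rightarrow> bool \<Rightarrow> (nat \<Rightarrow> nat) \<Rightarrow> nat \<Rightarrow> nat" where
  "inflate a b q i = (if i \<in> {a..a + 3} then q a + simple4 b (i - a) else stretch (q a) (q (squeeze a i)))"

lemma squeeze_stretch: "squeeze a (stretch a i) = i"
  by (auto simp: squeeze_def stretch_def)

lemma stretch_squeeze: "i \<notin> {a..a + 3} \<Longrightarrow> stretch a (squeeze a i) = i"
  by (auto simp: squeeze_def stretch_def)

lemma squeeze_eq_iff: "squeeze a i = squeeze a j \<longleftrightarrow> i = j \<or> i \<in> {a..a + 3} \<and> j \<in> {a..a + 3}"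
  by (cases "i \<le> a"; cases "i \<le> a + 3"; cases "j \<le> a"; cases "j \<le> a + 3") (auto simp: squeeze_def)

lemma squeeze_eq_self_iff: "squeeze a i = a \<longleftrightarrow> i \<in> {a..a + 3}"
  by (auto simp: squeeze_def)

lemma stretch_in_iff: "stretch a i \<in> {a..a + 3} \<longleftrightarrow> i = a"
  by (auto simp: stretch_def)

lemma squeeze_range: "a \<in> {1..m} \<Longrightarrow> i \<in> {1..m + 3} \<Longrightarrow> squeeze a i \<in> {1..m}"
  by (auto simp: squeeze_def)

lemma stretch_range: "i \<in> {1..m} \<Longrightarrow> stretch a i \<in> {1..m + 3}"
  by (auto simp: stretch_def)

lemma simple4_le: "simple4 b t \<le> 3"
  by (auto simp: simple4_def)

text \<open>The two patterns are inverse to each other.\<close>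
lemma simple4_inverse:
  assumes "s \<le> 3"
  shows "simple4 b (simple4 (\<not> b) s) = s"
proof -
  have "s = 0 \<or> s = 1 \<or> s = 2 \<or> s = 3" using assms by linarith
  then show ?thesis by (elim disjE) (simp_all add: simple4_def)
qed

lemma simple4_inj:
  assumes "simple4 b s = simple4 b t" "s \<le> 3" "t \<le> 3"
  shows "s = t"
proof -
  have "simple4 (\<not> b) (simple4 (\<not> \<not> b) s) = simple4 (\<not> b) (simple4 (\<not> \<not> b) t)"
    unfolding not_not by (rule arg_cong[OF assms(1)])
  then show ?thesis unfolding simple4_inverse[OF assms(2)] simple4_inverse[OF assms(3)] .
qed

lemma simple4_surj: "s \<le> 3 \<Longrightarrow> \<exists>t\<le>3. simple4 b t = s"
  by (rule exI[of _ "simple4 (\<not> b) s"], rule conjI[OF simple4_le simple4_inverse])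

lemma inflate_block: "t \<le> 3 \<Longrightarrow> inflate a b q (a + t) = q a + simple4 b t"
  by (simp add: inflate_def)

lemma inflate_outside: "i \<notin> {a..a + 3} \<Longrightarrow> inflate a b q i = stretch (q a) (q (squeeze a i))"
  unfolding inflate_def by (rule if_not_P)

text
  \<open>This intertwining relation is what carries blocks of the inflation over to the original permutation.\<close>
lemma squeeze_inflate: "squeeze (q a) (inflate a b q i) = q (squeeze a i)"
proof (cases "i \<in> {a..a + 3}")
  case True
  then have "squeeze a i = a" by (simp only: squeeze_eq_self_iff)
  moreover have "inflate a b q i \<in> {q a..q a + 3}"
    using True simple4_le[of b "i - a"] by (simp add: inflate_def)
  ultimately show ?thesis using squeeze_eq_self_iff by metis
next
  case False
  show ?thesis unfolding inflate_outside[OF False] squeeze_stretch ..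
qed

lemma inflate_perms:
  assumes q: "q \<in> perms m" and a: "a \<in> {1..m}"
  shows "inflate a b q \<in> perms (m + 3)"
proof (rule permsI)
  have c: "q a \<in> {1..m}" by (rule perms_range[OF q a])
  show "inflate a b q i \<in> {1..m + 3}" if "i \<in> {1..m + 3}" for i
  proof (cases "i \<in> {a..a + 3}")
    case True
    then show ?thesis using c simple4_le[of b "i - a"] by (auto simp: inflate_def)
  next
    case False
    then show ?thesis
      unfolding inflate_outside[OF False] by (intro stretch_range perms_range[OF q] squeeze_range a that)
  qed
  show "inj_on (inflate a b q) {1..m + 3}"
  proof (rule inj_onI)
    fix i j assume eq: "inflate a b q i = inflate a b q j"
    then have "q (squeeze a i) = q (squeeze a j)" by (metis squeeze_inflate)
    then have "squeeze a i = squeeze a j" by (rule perms_inj[OF q])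
    then consider "i = j" | "i \<in> {a..a + 3}" "j \<in> {a..a + 3}" by (auto simp: squeeze_eq_iff)
    then show "i = j"
    proof cases
      case 2
      then have "simple4 b (i - a) = simple4 b (j - a)" using eq by (simp add: inflate_def)
      then have "i - a = j - a" by (rule simple4_inj) (use 2 in auto)
      then show ?thesis using 2 by auto
    qed
  qed
  show "inflate a b q i = i" if i: "i \<notin> {1..m + 3}" for i
  proof -
    have out: "i \<notin> {a..a + 3}" "squeeze a i \<notin> {1..m}" using a i by (auto simp: squeeze_def)
    have "inflate a b q i = stretch (q a) (squeeze a i)"
      unfolding inflate_outside[OF out(1)] perms_outside[OF q out(2)] ..
    also have "\<dots> = i" using a c i by (auto simp: squeeze_def stretch_def)
    finally show ?thesis .
  qed
qed

text \<open>Shrinking the block, on positions and on values, inverts the inflation.\<close>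
lemma inflate_exists:
  assumes p: "p \<in> perms (m + 3)" and a: "a \<in> {1..m}" and c: "c \<in> {1..m}"
    and pt: "\<And>t. t \<le> 3 \<Longrightarrow> p (a + t) = c + simple4 b t"
  shows "\<exists>q\<in>perms m. p = inflate a b q"
proof -
  define q where "q i = squeeze c (p (stretch a i))" for i
  have block: "p i \<in> {c..c + 3} \<longleftrightarrow> i \<in> {a..a + 3}" for i
  proof
    assume "i \<in> {a..a + 3}"
    then have "i = a + (i - a)" "i - a \<le> 3" by auto
      then obtain t where "i = a + t" "t \<le> 3" by blast
    then show "p i \<in> {c..c + 3}" using pt[of t] simple4_le[of b t] by simp
  next
    assume "p i \<in> {c..c + 3}"
    then have "p i - c \<le> 3" by auto
    then obtain t where "t \<le> 3" "simple4 b t = p i - c" using simple4_surj by blast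
    then have "p i = p (a + t)" using pt[of t] \<open>p i \<in> {c..c + 3}\<close> by simp
    then have "i = a + t" by (rule perms_inj[OF p])
    then show "i \<in> {a..a + 3}" using \<open>t \<le> 3\<close> by simp
  qed
  have "q \<in> perms m"
  proof (rule permsI)
    show "q i \<in> {1..m}" if "i \<in> {1..m}" for i
      unfolding q_def by (intro squeeze_range c perms_range[OF p] stretch_range that)
    show "inj_on q {1..m}"
    proof (rule inj_onI)
      fix i j assume "q i = q j"
      then have "p (stretch a i) = p (stretch a j) \<or> i = a \<and> j = a"
        unfolding q_def squeeze_eq_iff block stretch_in_iff by blast
      then show "i = j" using perms_inj[OF p] squeeze_stretch by metis
    qed
    show "q i = i" if "i \<notin> {1..m}" for i
    proof -
      have out: "stretch a i \<notin> {1..m + 3}" using that a by (auto simp: stretch_def)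
      have "q i = squeeze c (stretch a i)" unfolding q_def perms_outside[OF p out] ..
      also have "\<dots> = i" using that a c by (auto simp: squeeze_def stretch_def)
      finally show ?thesis .
    qed
  qed
  moreover have "p = inflate a b q"
  proof
    fix i
    have "q a = squeeze c (p a)" by (simp add: q_def stretch_def)
    moreover have "p a \<in> {c..c + 3}" by (simp only: block) simp
    ultimately have qa: "q a = c" by (metis squeeze_eq_self_iff)
    show "p i = inflate a b q i"
    proof (cases "i \<in> {a..a + 3}")
      case True
      then have "i = a + (i - a)" "i - a \<le> 3" by auto
      then obtain t where "i = a + t" "t \<le> 3" by blast
      then show ?thesis using pt[of t] inflate_block[of t a b q] qa by simp
    next
      case False
      then have out: "p i \<notin> {c..c + 3}" using block by blast
      show ?thesis
        unfolding inflate_outside[OF False] qa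
        unfolding q_def stretch_squeeze[OF False] stretch_squeeze[OF out] ..
    qed
  qed
  ultimately show ?thesis by blast
qed

lemma squeeze_mono: "i \<le> j \<Longrightarrow> squeeze a i \<le> squeeze a j"
  by (auto simp: squeeze_def)

lemma squeeze_image:
  assumes "x \<le> y"
  shows "squeeze a ` {x..y} = {squeeze a x..squeeze a y}"
proof (intro equalityI subsetI)
  fix z assume "z \<in> squeeze a ` {x..y}"
  then show "z \<in> {squeeze a x..squeeze a y}" using squeeze_mono by auto
next
  fix z assume z: "z \<in> {squeeze a x..squeeze a y}"
  have "\<exists>w. squeeze a w = z \<and> w \<in> {x..y}"
  proof (cases "z \<le> a")
    case True
    show ?thesis
    proof (cases "z = a \<and> a < x")
      case True
      then show ?thesis using z assms by (intro exI[of _ x]) (auto simp: squeeze_def split: if_splits)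
    next
      case False
      then show ?thesis using z assms \<open>z \<le> a\<close>
        by (intro exI[of _ z]) (auto simp: squeeze_def split: if_splits)
    qed
  next
    case False
    then show ?thesis using z assms by (intro exI[of _ "z + 3"]) (auto simp: squeeze_def split: if_splits)
  qed
  then show "z \<in> squeeze a ` {x..y}" by blast
qed

text \<open>Shrinking maps intervals to intervals, of positions as well as of values.\<close>
lemma is_block_squeeze:
  assumes q: "q \<in> perms m" and a: "a \<in> {1..m}" and B: "is_block (m + 3) (inflate a b q) B"
  shows "is_block m q (squeeze a ` B)"
proof -
  obtain x y f g where xy: "x \<le> y" "B = {x..y}" and fg: "inflate a b q ` B = {f..g}" and sub: "B \<subseteq> {1..m + 3}"
    using B unfolding is_block_def by blast
  have "inflate a b q x \<in> {f..g}" unfolding fg[symmetric] xy(2) using xy(1) by (intro imageI) simp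
  then have "f \<le> g" by simp
  have image: "squeeze a ` B = {squeeze a x..squeeze a y}"
    unfolding xy(2) by (rule squeeze_image[OF xy(1)])
  have "q ` squeeze a ` B = squeeze (q a) ` inflate a b q ` B"
    by (simp only: image_image squeeze_inflate)
  also have "\<dots> = {squeeze (q a) f..squeeze (q a) g}"
    unfolding fg by (rule squeeze_image[OF \<open>f \<le> g\<close>])
  finally have vals: "q ` squeeze a ` B = {squeeze (q a) f..squeeze (q a) g}" .
  show ?thesis unfolding is_block_def
  proof (intro conjI)
    show "squeeze a ` B \<subseteq> {1..m}" by (intro image_subsetI squeeze_range[OF a] subsetD[OF sub])
    show "\<exists>l u. l \<le> u \<and> squeeze a ` B = {l..u}"
      by (rule exI[of _ "squeeze a x"], rule exI[of _ "squeeze a y"],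
          rule conjI[OF squeeze_mono[OF xy(1)] image])
    show "\<exists>l u. q ` squeeze a ` B = {l..u}"
      by (rule exI[of _ "squeeze (q a) f"], rule exI[of _ "squeeze (q a) g"], rule vals)
  qed
qed

section \<open>Blocks of simple and of corner-free permutations\<close>

lemma is_blockE:
  assumes p: "p \<in> perms n" and B: "is_block n p B"
  obtains x y f g where "B = {x..y}" "p ` B = {f..g}" "1 \<le> x" "x \<le> y" "y \<le> n"
    "1 \<le> f" "f \<le> g" "g \<le> n" "y - x = g - f"
proof -
  obtain x y f g where xy: "x \<le> y" "B = {x..y}" and fg: "p ` B = {f..g}" and sub: "B \<subseteq> {1..n}"
    using B unfolding is_block_def by blast
  have "p x \<in> {f..g}" unfolding fg[symmetric] xy(2) using xy(1) by (intro imageI) simp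
  then have "f \<le> g" by simp
  have "{f..g} \<subseteq> {1..n}"
    unfolding fg[symmetric] using sub perms_range[OF p] by (intro image_subsetI) (rule perms_range[OF p], rule subsetD[OF sub])
  then have "1 \<le> f" "g \<le> n" using \<open>f \<le> g\<close> by auto
  moreover have "1 \<le> x" "y \<le> n" using sub xy by auto
  moreover have "card (p ` B) = card B"
    by (intro card_image inj_onI) (rule perms_inj[OF p])
  then have "card {f..g} = card {x..y}" unfolding fg by (simp only: xy(2))
  then have "y - x = g - f" using xy(1) \<open>f \<le> g\<close> by simp
  ultimately show ?thesis using that xy fg \<open>f \<le> g\<close> by simp
qed

definition simple_perms :: "nat \<Rightarrow> (nat \<Rightarrow> nat) set" where
  "simple_perms n = {p. simple_perm n p}"

lemma simple_perms_block:
  assumes "p \<in> simple_perms n" "is_block n p {x..y}" "x < y"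
  shows "{x..y} = {1..n}"
proof -
  have "(\<exists>i. {x..y} = {i}) \<or> {x..y} = {1..n}"
    using assms(1,2) unfolding simple_perms_def simple_perm_def by blast
  moreover have "{x..y} \<noteq> {i}" for i
  proof
    assume eq: "{x..y} = {i}"
    have "x \<in> {x..y}" "y \<in> {x..y}" using assms(3) by auto
    then show False unfolding eq using assms(3) by simp
  qed
  ultimately show ?thesis by blast
qed

lemma simple_perms_subset_perms: "simple_perms n \<subseteq> perms n"
  by (auto simp: simple_perms_def simple_perm_def perms_def)

lemma adj_is_block:
  assumes "p \<in> perms n" "i \<in> {1..<n}" "adj p i"
  shows "is_block n p {i..Suc i}"
proof -
  have ij: "{i..Suc i} = {i, Suc i}" by auto
  have "p ` {i..Suc i} = {min (p i) (p (Suc i))..max (p i) (p (Suc i))}"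
    unfolding ij using assms(3) by (auto simp: adj_def)
  then show ?thesis unfolding is_block_def using assms(2) by (intro conjI exI) auto
qed

lemma corner_is_block:
  assumes p: "p \<in> perms n" and i: "i \<in> {1, n}" "p i \<in> {1, n}" and "n \<ge> 2"
  shows "is_block n p (if i = 1 then {2..n} else {1..n - 1})"
proof -
  let ?R = "\<lambda>j. if j = 1 then {2..n} else {1..n - 1}"
  have R: "{1..n} - {j} = ?R j" if "j \<in> {1, n}" for j using that assms(4) by auto
  have "p ` ?R i = p ` {1..n} - {p i}"
    unfolding R[OF i(1), symmetric] using image_set_diff[of p "{1..n}" "{i}"] perms_inj[OF p]
    by (simp add: inj_def)
  also have "p ` {1..n} = {1..n}" using p permutes_image[of p "{1..n}"] by (simp add: perms_def)
  also have "{1..n} - {p i} = ?R (p i)" by (rule R[OF i(2)])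
  finally have "p ` ?R i = ?R (p i)" .
  moreover have "\<exists>a b. a \<le> b \<and> ?R j = {a..b}" for j
  proof (cases "j = 1")
    case True
    then show ?thesis using assms(4) by (intro exI[of _ 2] exI[of _ n]) simp
  next
    case False
    then show ?thesis using assms(4) by (intro exI[of _ 1] exI[of _ "n - 1"]) simp
  qed
  moreover have "?R i \<subseteq> {1..n}" by auto
  ultimately show ?thesis unfolding is_block_def by metis
qed

text
  \<open>An adjacency is a block of length 2, and the positions other than a corner form a block of length \<open>n - 1\<close>.\<close>
lemma simple_perms_subset_corner_free:
  assumes n: "n \<ge> 3"
  shows "simple_perms n \<subseteq> corner_free n"
proof
  fix p assume s: "p \<in> simple_perms n"
  then have p: "p \<in> perms n" using simple_perms_subset_perms by blast
  have "\<not> adj p i" if i: "i \<in> {1..<n}" for i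
  proof
    assume "adj p i"
    then have "{i..Suc i} = {1..n}"
      using simple_perms_block[OF s adj_is_block[OF p i]] by simp
    then have "card {i..Suc i} = card {1..n}" by (simp only:)
    then show False using n by simp
  qed
  moreover have "p i \<notin> {1, n}" if i: "i \<in> {1, n}" for i
  proof
    assume "p i \<in> {1, n}"
    from corner_is_block[OF p i this] have b: "is_block n p (if i = 1 then {2..n} else {1..n - 1})"
      using n by simp
    show False
    proof (cases "i = 1")
      case True
      then have "{2..n} = {1..n}" using simple_perms_block[OF s, of 2 n] b n by simp
      then have "card {2..n} = card {1..n}" by (simp only:)
      then show False using n by simp
    next
      case False
      then have "{1..n - 1} = {1..n}" using simple_perms_block[OF s, of 1 "n - 1"] b n by simp
      then have "card {1..n - 1} = card {1..n}" by (simp only:)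
      then show False using n by simp
    qed
  qed
  ultimately show "p \<in> corner_free n" using p by (auto simp: corner_free_def adj_free_def)
qed

text
  \<open>Among the 24 patterns of length four only 2413 and 3142 have no neighbouring values in neighbouring positions.\<close>
lemma pattern_of_four:
  assumes p: "p \<in> perms n" and img: "p ` {x..x + 3} = {f..f + 3}"
    and na: "\<not> adj p x" "\<not> adj p (x + 1)" "\<not> adj p (x + 2)"
  shows "\<exists>b. \<forall>t\<le>3. p (x + t) = f + simple4 b t"
proof -
  have "\<exists>d\<le>3. p (x + t) = f + d" if "t \<le> 3" for t
  proof -
    have "p (x + t) \<in> {f..f + 3}" unfolding img[symmetric] using that by (intro imageI) simp
    then show ?thesis by (intro exI[of _ "p (x + t) - f"]) auto
  qed
  from this[of 0] this[of 1] this[of 2] this[of 3]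
  obtain d0 d1 d2 d3 where d: "p x = f + d0" "p (x + 1) = f + d1" "p (x + 2) = f + d2" "p (x + 3) = f + d3"
    and le: "d0 \<le> 3" "d1 \<le> 3" "d2 \<le> 3" "d3 \<le> 3" by auto
  have inj: "p i \<noteq> p j" if "i \<noteq> j" for i j using that perms_inj[OF p] by blast
  have ne: "d0 \<noteq> d1" "d0 \<noteq> d2" "d0 \<noteq> d3" "d1 \<noteq> d2" "d1 \<noteq> d3" "d2 \<noteq> d3"
    using inj[of x "x + 1"] inj[of x "x + 2"] inj[of x "x + 3"] inj[of "x + 1" "x + 2"]
      inj[of "x + 1" "x + 3"] inj[of "x + 2" "x + 3"] unfolding d by simp_all
  have step: "d1 \<noteq> Suc d0" "d0 \<noteq> Suc d1" "d2 \<noteq> Suc d1" "d1 \<noteq> Suc d2" "d3 \<noteq> Suc d2" "d2 \<noteq> Suc d3"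
  proof -
    have s: "Suc x = x + 1" "Suc (x + 1) = x + 2" "Suc (x + 2) = x + 3" by simp_all
    show "d1 \<noteq> Suc d0" "d0 \<noteq> Suc d1" "d2 \<noteq> Suc d1" "d1 \<noteq> Suc d2" "d3 \<noteq> Suc d2" "d2 \<noteq> Suc d3"
      using na unfolding adj_def s d by simp_all
  qed
  have "d0 = 1 \<and> d1 = 3 \<and> d2 = 0 \<and> d3 = 2 \<or> d0 = 2 \<and> d1 = 0 \<and> d2 = 3 \<and> d3 = 1"
  proof -
    let ?D = "{0, 1, 2, 3} :: nat set"
    have "\<forall>d0\<in>?D. \<forall>d1\<in>?D. d0 \<noteq> d1 \<and> d1 \<noteq> Suc d0 \<and> d0 \<noteq> Suc d1 \<longrightarrow>
      (\<forall>d2\<in>?D. d0 \<noteq> d2 \<and> d1 \<noteq> d2 \<and> d2 \<noteq> Suc d1 \<and> d1 \<noteq> Suc d2 \<longrightarrow>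
      (\<forall>d3\<in>?D. d0 \<noteq> d3 \<and> d1 \<noteq> d3 \<and> d2 \<noteq> d3 \<and> d3 \<noteq> Suc d2 \<and> d2 \<noteq> Suc d3 \<longrightarrow>
        d0 = 1 \<and> d1 = 3 \<and> d2 = 0 \<and> d3 = 2 \<or> d0 = 2 \<and> d1 = 0 \<and> d2 = 3 \<and> d3 = 1))"
      by simp
    moreover have "d \<in> ?D" if "d \<le> 3" for d using that by auto
    ultimately show ?thesis using ne step le by blast
  qed
  then have "\<exists>b. d0 = simple4 b 0 \<and> d1 = simple4 b 1 \<and> d2 = simple4 b 2 \<and> d3 = simple4 b 3"
  proof
    assume "d0 = 1 \<and> d1 = 3 \<and> d2 = 0 \<and> d3 = 2"
    then show ?thesis by (intro exI[of _ True]) (simp add: simple4_def)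
  next
    assume "d0 = 2 \<and> d1 = 0 \<and> d2 = 3 \<and> d3 = 1"
    then show ?thesis by (intro exI[of _ False]) (simp add: simple4_def)
  qed
  then obtain b where b: "d0 = simple4 b 0" "d1 = simple4 b 1" "d2 = simple4 b 2" "d3 = simple4 b 3" by blast
  have "p (x + t) = f + simple4 b t" if "t \<le> 3" for t
  proof -
    have "t = 0 \<or> t = 1 \<or> t = 2 \<or> t = 3" using that by linarith
    then show ?thesis using d b by auto
  qed
  then show ?thesis by blast
qed

section \<open>Long blocks are rare\<close>

text
  \<open>Log-convexity: a product of two factorials with given sum of arguments grows when the arguments move apart.\<close>
lemma fact_mult_le: "c \<le> b \<Longrightarrow> fact (c + d) * fact b \<le> fact c * (fact (b + d) :: nat)"
proof (induction d)
  case (Suc d)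
  have "fact (c + Suc d) * fact b = (c + d + 1) * (fact (c + d) * (fact b :: nat))" by (simp add: algebra_simps)
  also have "\<dots> \<le> (b + d + 1) * (fact c * fact (b + d))"
    by (rule mult_le_mono[OF _ Suc.IH[OF Suc.prems]]) (use Suc.prems in simp)
  also have "\<dots> = fact c * fact (b + Suc d)" by (simp add: algebra_simps)
  finally show ?case .
qed simp

text \<open>A permutation preserving \<open>A\<close> is determined by its restrictions to \<open>A\<close> and to the
  complement.\<close>
lemma card_perms_image_self:
  assumes A: "A \<subseteq> {1..n}"
  shows "card {p \<in> perms n. p ` A = A} \<le> fact (card A) * fact (n - card A)"
proof -
  let ?N = "{1..n} - A" and ?S = "{p \<in> perms n. p ` A = A}"
  let ?r = "\<lambda>p. (restrict_id p A, restrict_id p ?N)"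
  have fin: "finite A" "finite ?N" using A finite_subset[OF A] by auto
  have "inj_on ?r ?S"
  proof (rule inj_onI)
    fix p q assume p: "p \<in> ?S" and q: "q \<in> ?S" and eq: "?r p = ?r q"
    show "p = q"
    proof
      fix i
      have "restrict_id p A i = restrict_id q A i" "restrict_id p ?N i = restrict_id q ?N i"
        using eq by simp_all
      then show "p i = q i"
        using perms_outside[of p n i] perms_outside[of q n i] p q
        by (auto simp: restrict_id_def split: if_splits)
    qed
  qed
  moreover have "?r ` ?S \<subseteq> {p. p permutes A} \<times> {p. p permutes ?N}"
  proof (rule image_subsetI)
    fix p assume p: "p \<in> ?S"
    then have inj: "inj p" using perms_inj[of p n] by (auto simp: inj_def)
    have "p ` ?N = p ` {1..n} - p ` A" by (rule image_set_diff[OF inj])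
    also have "\<dots> = ?N" using p permutes_image[of p "{1..n}"] by (simp add: perms_def)
    finally have "bij_betw p ?N ?N" "bij_betw p A A"
      using p inj by (auto simp: bij_betw_def intro: inj_on_subset)
    then show "?r p \<in> {p. p permutes A} \<times> {p. p permutes ?N}"
      by (simp add: permutes_restrict_id)
  qed
  ultimately have "card ?S \<le> card ({p. p permutes A} \<times> {p. p permutes ?N})"
    using fin by (intro card_inj_on_le) (auto intro!: finite_cartesian_product finite_permutations)
  also have "\<dots> = fact (card A) * fact (n - card A)"
    using fin card_Diff_subset[OF fin(1) A] by (simp add: card_cartesian_product card_permutations)
  finally show ?thesis .
qed

text
  \<open>Composing with the inverse of one such permutation reduces the count to the stabiliser of \<open>A\<close>.\<close>
lemma card_perms_image:
  assumes A: "A \<subseteq> {1..n}"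
  shows "card {p \<in> perms n. p ` A = C} \<le> fact (card A) * fact (n - card A)"
proof (cases "{p \<in> perms n. p ` A = C} = {}")
  case False
  then obtain p0 where p0: "p0 \<in> perms n" "p0 ` A = C" by blast
  have perm: "p0 permutes {1..n}" using p0(1) by (simp add: perms_def)
  have "inj_on (\<lambda>p. inv p0 \<circ> p) {p \<in> perms n. p ` A = C}"
  proof (rule inj_onI)
    fix p q assume "inv p0 \<circ> p = inv p0 \<circ> q"
    then have "p0 \<circ> (inv p0 \<circ> p) = p0 \<circ> (inv p0 \<circ> q)" by simp
    then show "p = q" using permutes_inv_o(1)[OF perm] by (simp add: comp_assoc[symmetric])
  qed
  moreover have "(\<lambda>p. inv p0 \<circ> p) ` {p \<in> perms n. p ` A = C} \<subseteq> {p \<in> perms n. p ` A = A}"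
  proof (rule image_subsetI)
    fix p assume p: "p \<in> {p \<in> perms n. p ` A = C}"
    have "(inv p0 \<circ> p) ` A = (inv p0 \<circ> p0) ` A" using p p0(2) by (simp only: image_comp[symmetric]) simp
    also have "\<dots> = A" unfolding permutes_inv_o(2)[OF perm] by simp
    finally show "inv p0 \<circ> p \<in> {p \<in> perms n. p ` A = A}"
      using p permutes_compose[OF _ permutes_inv[OF perm]] by (simp add: perms_def)
  qed
  ultimately have "card {p \<in> perms n. p ` A = C} \<le> card {p \<in> perms n. p ` A = A}"
    by (rule card_inj_on_le) simp
  then show ?thesis using card_perms_image_self[OF A] by linarith
next
  case True
  show ?thesis unfolding True by simp
qed

text \<open>Written as a union over explicit pairs of intervals, ready for the union bound.\<close>
definition wide_block_perms :: "nat \<Rightarrow> (nat \<Rightarrow> nat) set" where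
  "wide_block_perms n = (\<Union>k\<in>{5..n - 3}. \<Union>x\<in>{1..n - k + 1}. \<Union>f\<in>{1..n - k + 1}.
     {p \<in> perms n. p ` {x..<x + k} = {f..<f + k}})"

lemma wide_block_term_le:
  assumes k: "k \<in> {5..n - 3}"
  shows "(n - k + 1) * ((n - k + 1) * (fact k * fact (n - k))) \<le> fact k * (fact (n - k + 2) :: nat)"
proof -
  have "(n - k + 1) * ((n - k + 1) * fact (n - k)) \<le> (n - k + 2) * ((n - k + 1) * (fact (n - k) :: nat))"
    by (intro mult_le_mono) auto
  also have "\<dots> = fact (n - k + 2)" by simp
  finally have "fact k * ((n - k + 1) * ((n - k + 1) * fact (n - k))) \<le> fact k * (fact (n - k + 2) :: nat)"
    by (rule mult_le_mono2)
  then show ?thesis by (simp only: mult_ac)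
qed

text \<open>By log-convexity the terms \<open>k! (n - k + 2)!\<close> are largest for the two extreme lengths,
  where they equal \<open>5! (n - 3)!\<close>; all others are at most \<open>6! (n - 4)!\<close>, and there are fewer
  than \<open>2 (n - 3)\<close> of them.\<close>
lemma card_wide_block_perms:
  assumes n: "n \<ge> 8"
  shows "card (wide_block_perms n) \<le> 1680 * fact (n - 3)"
proof -
  obtain m where m: "n = m + 8" using n by (metis add.commute le_Suc_ex)
  have "card (wide_block_perms n) \<le> (\<Sum>k\<in>{5..n - 3}. \<Sum>x\<in>{1..n - k + 1}. \<Sum>f\<in>{1..n - k + 1}.
     card {p \<in> perms n. p ` {x..<x + k} = {f..<f + k}})"
    unfolding wide_block_perms_def
    by (intro card_UN_le[THEN order.trans] sum_mono finite_atLeastAtMost order.refl)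
  also have "\<dots> \<le> (\<Sum>k\<in>{5..n - 3}. \<Sum>x\<in>{1..n - k + 1}. \<Sum>f\<in>{1..n - k + 1}. fact k * fact (n - k))"
  proof (intro sum_mono)
    fix k x f assume k: "k \<in> {5..n - 3}" and x: "x \<in> {1..n - k + 1}"
    then have "{x..<x + k} \<subseteq> {1..n}" by auto
    from card_perms_image[OF this, of "{f..<f + k}"]
    show "card {p \<in> perms n. p ` {x..<x + k} = {f..<f + k}} \<le> fact k * fact (n - k)" by simp
  qed
  also have "\<dots> = (\<Sum>k\<in>{5..n - 3}. (n - k + 1) * ((n - k + 1) * (fact k * fact (n - k))))"
    by simp
  also have "\<dots> \<le> (\<Sum>k\<in>{5..n - 3}. fact k * fact (n - k + 2))"
    by (intro sum_mono wide_block_term_le)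
  also have "{5..n - 3} = insert 5 (insert (n - 3) {6..n - 4})" using n by auto
  also have "(\<Sum>k\<in>insert 5 (insert (n - 3) {6..n - 4}). fact k * fact (n - k + 2))
     \<le> fact 5 * fact (n - 5 + 2) + (fact (n - 3) * fact (n - (n - 3) + 2)
       + (\<Sum>k\<in>{6..n - 4}. fact k * (fact (n - k + 2) :: nat)))"
    by (simp add: sum.insert_if)
  also have "\<dots> \<le> 120 * fact (n - 3) + (120 * fact (n - 3) + 1440 * fact (n - 3))"
  proof (intro add_mono)
    have "n - 5 + 2 = n - 3" "n - (n - 3) + 2 = 5" using n by auto
    moreover have "fact 5 = (120 :: nat)" by (simp add: fact_numeral)
    ultimately show "fact 5 * fact (n - 5 + 2) \<le> 120 * (fact (n - 3) :: nat)"
      "fact (n - 3) * fact (n - (n - 3) + 2) \<le> 120 * (fact (n - 3) :: nat)" by simp_all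
    have "(\<Sum>k\<in>{6..n - 4}. fact k * (fact (n - k + 2) :: nat)) \<le> (\<Sum>k\<in>{6..n - 4}. 720 * fact (n - 4))"
    proof (rule sum_mono)
      fix k assume k: "k \<in> {6..n - 4}"
      then have eqs: "6 + (k - 6) = k" "n - k + 2 + (k - 6) = n - 4" and le: "6 \<le> n - k + 2" by auto
      have "fact k * fact (n - k + 2) \<le> fact 6 * (fact (n - 4) :: nat)"
        using fact_mult_le[OF le, of "k - 6"] unfolding eqs .
      then show "fact k * fact (n - k + 2) \<le> 720 * (fact (n - 4) :: nat)" by (simp add: fact_numeral)
    qed
    also have "\<dots> \<le> 2 * (n - 3) * (720 * fact (n - 4))"
      using n by (simp only: sum_constant of_nat_id card_atLeastAtMost) (intro mult_le_mono1, simp)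
    also have "\<dots> = 1440 * ((n - 3) * fact (n - 4))" by simp
    also have "(n - 3) * fact (n - 4) = (fact (n - 3) :: nat)"
      unfolding m by (simp add: numeral_eq_Suc)
    finally show "(\<Sum>k\<in>{6..n - 4}. fact k * (fact (n - k + 2) :: nat)) \<le> 1440 * fact (n - 3)" .
  qed
  finally show ?thesis by simp
qed

definition four_block_perms :: "nat \<Rightarrow> (nat \<Rightarrow> nat) set" where
  "four_block_perms n = {p \<in> corner_free n. \<exists>x\<in>{1..n - 3}. \<exists>f\<in>{1..n - 3}. p ` {x..x + 3} = {f..f + 3}}"

text \<open>For each of the lengths 2, 3, \<open>n - 2\<close> and \<open>n - 1\<close>, a block would produce an adjacency
  or a corner. For the two long ones look at the complement: its one or two positions, at
  the ends, carry the one or two values outside the block, which lie at the ends of the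
  range too.\<close>
lemma corner_free_not_simple:
  assumes n: "n \<ge> 4"
  shows "corner_free n - simple_perms n \<subseteq> four_block_perms n \<union> wide_block_perms n"
proof
  fix p assume "p \<in> corner_free n - simple_perms n"
  then have cf: "p \<in> corner_free n" and ns: "p \<notin> simple_perms n" by auto
  then have p: "p \<in> perms n" by (simp add: corner_free_def adj_free_def)
  have na: "p (Suc i) \<noteq> Suc (p i)" "p i \<noteq> Suc (p (Suc i))" if "i \<in> {1..<n}" for i
    using cf that by (auto simp: corner_free_def adj_free_def adj_def)
  have nc: "p 1 \<noteq> 1" "p 1 \<noteq> n" "p n \<noteq> 1" "p n \<noteq> n"
    using cf by (auto simp: corner_free_def)
  obtain B where B: "is_block n p B" "\<And>i. B \<noteq> {i}" "B \<noteq> {1..n}"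
    using ns p unfolding simple_perms_def simple_perm_def perms_def by blast
  from is_blockE[OF p B(1)] obtain x y f g where b: "B = {x..y}" "p ` B = {f..g}" "1 \<le> x" "x \<le> y" "y \<le> n"
    "1 \<le> f" "f \<le> g" "g \<le> n" and d: "y - x = g - f" by metis
  have img: "p ` {x..y} = {f..g}" using b by simp
  have inside: "p i \<in> {f..g}" if "i \<in> {x..y}" for i unfolding img[symmetric] using that by (rule imageI)
  have outside: "p i \<notin> {f..g} \<and> p i \<in> {1..n}" if i: "i \<in> {1..n}" "i \<notin> {x..y}" for i
  proof
    show "p i \<in> {1..n}" by (rule perms_range[OF p i(1)])
    show "p i \<notin> {f..g}" unfolding img[symmetric]
    proof
      assume "p i \<in> p ` {x..y}"
      then obtain j where "j \<in> {x..y}" "p i = p j" by blast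
      then show False using i(2) perms_inj[OF p] by metis
    qed
  qed
  have inj: "p i \<noteq> p j" if "i \<noteq> j" for i j using that perms_inj[OF p] by blast
  have "x < y"
  proof (rule ccontr)
    assume "\<not> x < y"
    then show False using b(1,4) B(2)[of x] by simp
  qed
  have "y - x \<noteq> n - 1"
  proof
    assume "y - x = n - 1"
    then have "x = 1" "y = n" using b n by auto
    then show False using b(1) B(3) by simp
  qed
  have "y - x \<noteq> 1"
  proof
    assume k: "y - x = 1"
    then have "y = Suc x" "g = Suc f" using d b by auto
    then show False using inside[of x] inside[of "Suc x"] na[of x] inj[of x "Suc x"] b(3,5) by auto
  qed
  moreover have "y - x \<noteq> 2"
  proof
    assume k: "y - x = 2"
    then have yg: "y = Suc (Suc x)" "g = Suc (Suc f)" using d b by auto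
    have "p i = f \<or> p i = Suc f \<or> p i = Suc (Suc f)" if "i \<in> {x, Suc x, Suc (Suc x)}" for i
      using inside[of i] that yg by auto
    from this[of x] this[of "Suc x"] this[of "Suc (Suc x)"]
    show False using na[of x] na[of "Suc x"] inj[of x "Suc x"] inj[of x "Suc (Suc x)"]
      inj[of "Suc x" "Suc (Suc x)"] b(3,5) yg(1) by auto
  qed
  moreover have "y - x \<noteq> n - 2"
  proof
    assume k: "y - x = n - 2"
    then have xy: "x = 1 \<and> y = n - 1 \<or> x = 2 \<and> y = n" and fg: "f = 1 \<and> g = n - 1 \<or> f = 2 \<and> g = n"
      using b d n by auto
    (* The position outside the block. *)
    define e where "e = (if x = 1 then n else 1)"
    have "e \<in> {1..n}" "e \<notin> {x..y}" using xy n by (auto simp: e_def)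
    from outside[OF this] have "p e = 1 \<or> p e = n" using fg by auto
    then show False using nc by (auto simp: e_def split: if_splits)
  qed
  moreover have "y - x \<noteq> n - 3"
  proof
    assume k: "y - x = n - 3"
    have xy: "x = 1 \<and> y = n - 2 \<or> x = 2 \<and> y = n - 1 \<or> x = 3 \<and> y = n"
      using b(3-5) k n by linarith
    have fg: "f = 1 \<and> g = n - 2 \<or> f = 2 \<and> g = n - 1 \<or> f = 3 \<and> g = n"
      using b(6-8) k d n by linarith
    have out: "f = 1 \<and> (p i = n - 1 \<or> p i = n) \<or> f = 2 \<and> (p i = 1 \<or> p i = n) \<or> f = 3 \<and> (p i = 1 \<or> p i = 2)"
      if "i \<in> {1..n}" "i \<notin> {x..y}" for i
      using outside[OF that] fg n by auto
    from xy consider "x = 1" "y = n - 2" | "x = 2" "y = n - 1" | "x = 3" "y = n" by blast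
    then show False
    proof cases
      case 1
      obtain m where m: "n = Suc m" "m \<ge> 3" using n by (cases n) auto
      have "p m \<noteq> p n" "p n \<noteq> Suc (p m)" "p m \<noteq> Suc (p n)"
        using inj[of m n] na[of m] m by auto
      moreover have "m \<in> {1..n}" "m \<notin> {x..y}" "n \<in> {1..n}" "n \<notin> {x..y}" using 1 m by auto
      note out[OF this(1,2)] out[OF this(3,4)]
      ultimately show False using m nc by auto
    next
      case 2
      have "p 1 \<noteq> p n" using inj[of 1 n] n by simp
      moreover have "1 \<in> {1..n}" "1 \<notin> {x..y}" "n \<in> {1..n}" "n \<notin> {x..y}" using 2 n by auto
      note out[OF this(1,2)] out[OF this(3,4)]
      ultimately show False using n nc by auto
    next
      case 3
      have "p 1 \<noteq> p 2" "p 2 \<noteq> Suc (p 1)" "p 1 \<noteq> Suc (p 2)"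
        using inj[of 1 2] na[of 1] n by (auto simp: numeral_2_eq_2)
      moreover have "1 \<in> {1..n}" "1 \<notin> {x..y}" "2 \<in> {1..n}" "2 \<notin> {x..y}" using 3 n by auto
      note out[OF this(1,2)] out[OF this(3,4)]
      ultimately show False using n nc by auto
    qed
  qed
  ultimately have k: "3 \<le> y - x" "y - x + 4 \<le> n"
    using \<open>x < y\<close> \<open>y - x \<noteq> n - 1\<close> b(3-5) n by linarith+
  show "p \<in> four_block_perms n \<union> wide_block_perms n"
  proof (cases "y - x = 3")
    case True
    then have "y = x + 3" "g = f + 3" using b d by auto
    then have "x \<in> {1..n - 3}" "f \<in> {1..n - 3}" "p ` {x..x + 3} = {f..f + 3}" using b img by auto
    then show ?thesis using cf unfolding four_block_perms_def by blast
  next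
    case False
    define j where "j = Suc (y - x)"
    have "{x..<x + j} = {x..y}" "{f..<f + j} = {f..g}" using b d by (auto simp: j_def)
    then have "p ` {x..<x + j} = {f..<f + j}" using img by (simp only:)
    moreover have "j \<in> {5..n - 3}" "x \<in> {1..n - j + 1}" "f \<in> {1..n - j + 1}"
      using False k b d by (auto simp: j_def)
    ultimately show ?thesis using p unfolding wide_block_perms_def by blast
  qed
qed

section \<open>Permutations with a block of length four\<close>

definition adj_only_at :: "nat \<Rightarrow> nat \<Rightarrow> (nat \<Rightarrow> nat) set" where
  "adj_only_at m a = {q \<in> perms m. \<forall>i\<in>{1..<m}. adj q i \<longrightarrow> i = a \<or> Suc i = a}"

lemma card_adj_at:
  assumes i: "i \<in> {1..<m}"
  shows "card {q \<in> perms m. adj q i} = 2 * fact (m - 1)"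
proof -
  have "{j \<in> {i}. j - 1 \<notin> {i}} = {i}" using i by auto
  then have "runs {i} = 1" unfolding runs_def by simp
  then show ?thesis using adj_count_eq[of "{i}" m] i by (simp add: adj_count_def)
qed

text \<open>An adjacency at a prescribed place has probability \<open>O(1/m)\<close>, so tolerating adjacencies
  at the point \<open>a\<close> costs little.\<close>
lemma card_adj_only_at_le:
  shows "card (adj_only_at m a) \<le> card (adj_free m) + 4 * fact (m - 1)"
proof -
  let ?I = "{a - 1, a} \<inter> {1..<m}"
  let ?U = "\<Union>i\<in>?I. {q \<in> perms m. adj q i}"
  have "adj_only_at m a \<subseteq> adj_free m \<union> ?U"
    by (auto simp: adj_only_at_def adj_free_def)
  then have "card (adj_only_at m a) \<le> card (adj_free m \<union> ?U)"
    by (intro card_mono) auto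
  also have "\<dots> \<le> card (adj_free m) + card ?U" by (rule card_Un_le)
  also have "card ?U \<le> (\<Sum>i\<in>?I. card {q \<in> perms m. adj q i})" by (rule card_UN_le) simp
  also have "\<dots> = card ?I * (2 * fact (m - 1))"
    by (simp add: card_adj_at)
  also have "\<dots> \<le> 2 * (2 * fact (m - 1))"
  proof (rule mult_le_mono1)
    have "card ?I \<le> card {a - 1, a}" by (intro card_mono) auto
    also have "\<dots> \<le> 2" by (simp add: card_insert_if)
    finally show "card ?I \<le> 2" .
  qed
  finally show ?thesis by simp
qed

text
  \<open>Adjacencies away from the inflated point survive the inflation, which shifts both of their entries in the same way.\<close>
lemma adj_inflate_outside:
  assumes "adj q i" "i \<noteq> a" "Suc i \<noteq> a" and inj: "\<And>j. q j = q a \<Longrightarrow> j = a"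
  shows "adj (inflate a b q) (stretch a i)"
proof -
  have s: "Suc (stretch a i) = stretch a (Suc i)" using assms(2,3) by (auto simp: stretch_def)
  have val: "inflate a b q (stretch a j) = stretch (q a) (q j)" if "j \<noteq> a" for j
  proof -
    have "stretch a j \<notin> {a..a + 3}" using that stretch_in_iff by simp
    then show ?thesis by (subst inflate_outside) (simp_all only: squeeze_stretch not_False_eq_True)
  qed
  have "q i \<noteq> q a" "q (Suc i) \<noteq> q a" using inj assms(2,3) by blast+
  then show ?thesis
    using assms(1) unfolding adj_def s val[OF assms(2)] val[OF assms(3)]
    by (auto simp: stretch_def)
qed

lemma four_block_perms_subset:
  "four_block_perms (m + 3) \<subseteq> (\<Union>b\<in>UNIV. \<Union>a\<in>{1..m}. inflate a b ` adj_only_at m a)"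
proof
  fix p assume "p \<in> four_block_perms (m + 3)"
  then obtain a c where cf: "p \<in> corner_free (m + 3)" and a: "a \<in> {1..m}" and c: "c \<in> {1..m}"
    and img: "p ` {a..a + 3} = {c..c + 3}"
    by (auto simp: four_block_perms_def)
  have p: "p \<in> perms (m + 3)" and na: "\<And>i. i \<in> {1..<m + 3} \<Longrightarrow> \<not> adj p i"
    using cf by (auto simp: corner_free_def adj_free_def)
  have "\<exists>b. \<forall>t\<le>3. p (a + t) = c + simple4 b t"
    by (rule pattern_of_four[OF p img]) (use na a in auto)
  then obtain b where b: "\<And>t. t \<le> 3 \<Longrightarrow> p (a + t) = c + simple4 b t" by blast
  obtain q where q: "q \<in> perms m" and pq: "p = inflate a b q"
    using inflate_exists[OF p a c b] by blast
  have "q \<in> adj_only_at m a"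
  proof -
    have "i = a \<or> Suc i = a" if i: "i \<in> {1..<m}" "adj q i" for i
    proof (rule ccontr)
      assume n: "\<not> (i = a \<or> Suc i = a)"
      have "adj p (stretch a i)"
        unfolding pq using i(2) n perms_inj[OF q] by (intro adj_inflate_outside) auto
      moreover have "stretch a i \<in> {1..<m + 3}" using i(1) by (auto simp: stretch_def)
      ultimately show False using na by blast
    qed
    then show ?thesis using q by (auto simp: adj_only_at_def)
  qed
  then show "p \<in> (\<Union>b\<in>UNIV. \<Union>a\<in>{1..m}. inflate a b ` adj_only_at m a)"
    using a pq by blast
qed

text \<open>Two patterns, \<open>m\<close> points to inflate, and for each of them the permutations whose
  adjacencies all involve that point.\<close>
lemma card_four_block_perms_le:
  assumes m: "m \<ge> 1"
  shows "card (four_block_perms (m + 3)) \<le> 2 * m * card (adj_free m) + 8 * fact m"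
proof -
  have fin: "finite (adj_only_at m a)" for a by (simp add: adj_only_at_def)
  have "card (four_block_perms (m + 3)) \<le> card (\<Union>b\<in>(UNIV::bool set). \<Union>a\<in>{1..m}. inflate a b ` adj_only_at m a)"
    by (intro card_mono four_block_perms_subset finite_UN_I finite_imageI fin) auto
  also have "\<dots> \<le> (\<Sum>b\<in>(UNIV::bool set). \<Sum>a\<in>{1..m}. card (inflate a b ` adj_only_at m a))"
    by (intro card_UN_le[THEN order.trans] sum_mono order.refl) auto
  also have "\<dots> \<le> (\<Sum>b\<in>(UNIV::bool set). \<Sum>a\<in>{1..m}. card (adj_free m) + 4 * fact (m - 1))"
    by (intro sum_mono order.trans[OF card_image_le[OF fin] card_adj_only_at_le])
  also have "\<dots> = 2 * m * card (adj_free m) + 8 * (m * fact (m - 1))"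
    by (simp add: UNIV_bool algebra_simps)
  also have "m * fact (m - 1) = fact m" using m by (simp add: fact_reduce)
  finally show ?thesis .
qed

lemma inflate_image_block:
  "inflate a b q ` {a..a + 3} = {q a..q a + 3}"
proof (intro equalityI subsetI)
  fix v assume "v \<in> inflate a b q ` {a..a + 3}"
  then obtain i where "i \<in> {a..a + 3}" "v = inflate a b q i" by blast
  then show "v \<in> {q a..q a + 3}" using simple4_le[of b "i - a"] by (simp add: inflate_def)
next
  fix v assume v: "v \<in> {q a..q a + 3}"
  then have "v - q a \<le> 3" by auto
  then obtain t where t: "t \<le> 3" "simple4 b t = v - q a" using simple4_surj by blast
  then have "v = inflate a b q (a + t)" using inflate_block[of t a b q] v by simp
  then show "v \<in> inflate a b q ` {a..a + 3}" using t(1) by (intro image_eqI[of _ _ "a + t"]) auto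
qed

text \<open>A block of length between 2 and \<open>m - 1\<close> that does not lie inside the inflated point
  would shrink to a nontrivial block of the simple permutation.\<close>
lemma inflate_simple_block:
  assumes q: "q \<in> simple_perms m" and a: "a \<in> {1..m}"
    and B: "is_block (m + 3) (inflate a b q) {x..y}" "x < y" "y - x + 2 \<le> m"
  shows "x \<in> {a..a + 3} \<and> y \<in> {a..a + 3}"
proof -
  have qp: "q \<in> perms m" using q simple_perms_subset_perms by blast
  have "is_block m q {squeeze a x..squeeze a y}"
    using is_block_squeeze[OF qp a B(1)] squeeze_image[of x y a] B(2) by simp
  moreover have "{squeeze a x..squeeze a y} \<noteq> {1..m}"
  proof
    assume "{squeeze a x..squeeze a y} = {1..m}"
    then have "card {squeeze a x..squeeze a y} = card {1..m}" by (simp only:)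
    then show False using B(2,3) by (auto simp: squeeze_def split: if_splits)
  qed
  ultimately have "\<not> squeeze a x < squeeze a y"
    using simple_perms_block[OF q] by blast
  then have "squeeze a x = squeeze a y"
    using squeeze_mono[of x y a] B(2) by simp
  then show ?thesis using B(2) by (simp add: squeeze_eq_iff)
qed

text
  \<open>Neither pattern has an adjacency or an extreme value at an end, so inflating creates no adjacency inside the block and no corner at it.\<close>
lemma inflate_simple_four_block:
  assumes q: "q \<in> simple_perms m" and a: "a \<in> {1..m}" and m: "m \<ge> 4"
  shows "inflate a b q \<in> four_block_perms (m + 3)"
proof -
  let ?p = "inflate a b q"
  have qcf: "q \<in> corner_free m" using q simple_perms_subset_corner_free[of m] m by auto
  have qp: "q \<in> perms m" using q simple_perms_subset_perms by blast
  have p: "?p \<in> perms (m + 3)" by (rule inflate_perms[OF qp a])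
  have c: "q a \<in> {1..m}" by (rule perms_range[OF qp a])
  have "\<not> adj ?p i" if i: "i \<in> {1..<m + 3}" for i
  proof
    assume adj: "adj ?p i"
    from inflate_simple_block[OF q a adj_is_block[OF p i adj]] m
    have "i \<in> {a..a + 3}" "Suc i \<in> {a..a + 3}" by auto
    then have "i = a + (i - a)" "i - a \<le> 2" by auto
    then obtain t where t: "i = a + t" "t \<le> 2" by blast
    have "?p i = q a + simple4 b t" "?p (Suc i) = q a + simple4 b (Suc t)"
      using inflate_block[of t a b q] inflate_block[of "Suc t" a b q] t by simp_all
    moreover have "t = 0 \<or> t = 1 \<or> t = 2" using t(2) by linarith
    ultimately show False using adj unfolding adj_def by (cases b) (auto simp: simple4_def)
  qed
  then have af: "?p \<in> adj_free (m + 3)" using p by (auto simp: adj_free_def)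
  have corner: "?p i \<noteq> 1 \<and> ?p i \<noteq> m + 3" if i: "i = 1 \<or> i = m + 3" for i
  proof (cases "i \<in> {a..a + 3}")
    case True
    then have "i = a \<or> i = a + 3" using i a by auto
    then have "?p i = q a + 1 \<or> ?p i = q a + 2" by (auto simp: inflate_def simple4_def)
    then show ?thesis using c by auto
  next
    case False
    then have "squeeze a i = (if i = 1 then 1 else m)" using i a by (auto simp: squeeze_def)
    then have "q (squeeze a i) \<noteq> 1" "q (squeeze a i) \<noteq> m"
      using qcf by (auto simp: corner_free_def)
    then show ?thesis unfolding inflate_outside[OF False] using c m by (auto simp: stretch_def)
  qed
  have "?p \<in> corner_free (m + 3)" using af corner by (simp add: corner_free_def)
  then show ?thesis
    unfolding four_block_perms_def using inflate_image_block[of a b q] a c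
    by (intro CollectI conjI bexI[of _ a] bexI[of _ "q a"]) simp_all
qed

text
  \<open>The inflated block is the only block of length four, so the inflation determines the point; the rest can then be read off.\<close>
lemma inflate_inj_on_simple:
  assumes m: "m \<ge> 5"
  shows "inj_on (\<lambda>(a, b, q). inflate a b q) ({1..m} \<times> UNIV \<times> simple_perms m)"
proof (rule inj_onI)
  fix u v
  assume uv: "u \<in> {1..m} \<times> UNIV \<times> simple_perms m" "v \<in> {1..m} \<times> UNIV \<times> simple_perms m"
    and f: "(\<lambda>(a, b, q). inflate a b q) u = (\<lambda>(a, b, q). inflate a b q) v"
  obtain a b q where u: "u = (a, b, q)" by (cases u)
  obtain a' b' q' where v: "v = (a', b', q')" by (cases v)
  have a: "a \<in> {1..m}" and a': "a' \<in> {1..m}" and q: "q \<in> simple_perms m" and q': "q' \<in> simple_perms m"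
    and eq: "inflate a b q = inflate a' b' q'"
    using uv f unfolding u v by simp_all
  have c': "q' a' \<in> {1..m}" using q' simple_perms_subset_perms perms_range[OF _ a'] by blast
  have "is_block (m + 3) (inflate a b q) {a'..a' + 3}"
    unfolding is_block_def eq using inflate_image_block[of a' b' q'] a'
    by (intro conjI exI[of _ a'] exI[of _ "a' + 3"] exI[of _ "q' a'"] exI[of _ "q' a' + 3"]) auto
  from inflate_simple_block[OF q a this] m have "a' \<in> {a..a + 3}" "a' + 3 \<in> {a..a + 3}" by auto
  then have aa: "a' = a" by auto
  have e: "q a + simple4 b t = q' a + simple4 b' t" if "t \<le> 3" for t
    using inflate_block[OF that, of a b q] inflate_block[OF that, of a b' q'] eq aa by simp
  have bb: "b = b'"
    using e[of 0] e[of 1] by (cases b; cases b') (simp_all add: simple4_def)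
  have cc: "q a = q' a" using e[of 0] bb by simp
  have "q i = q' i" for i
  proof -
    have "q i = squeeze (q a) (inflate a b q (stretch a i))" by (simp only: squeeze_inflate squeeze_stretch)
    also have "\<dots> = squeeze (q' a) (inflate a b' q' (stretch a i))" unfolding cc eq aa ..
    also have "\<dots> = q' i" by (simp only: squeeze_inflate squeeze_stretch)
    finally show ?thesis .
  qed
  then show "u = v" unfolding u v using aa bb by auto
qed

lemma card_four_block_perms_ge:
  assumes m: "m \<ge> 5"
  shows "2 * m * card (simple_perms m) \<le> card (four_block_perms (m + 3))"
proof -
  let ?f = "\<lambda>(a, b, q). inflate a b q" and ?A = "{1..m} \<times> (UNIV :: bool set) \<times> simple_perms m"
  have fin: "finite (four_block_perms (m + 3))" by (simp add: four_block_perms_def corner_free_def)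
  have "?f ` ?A \<subseteq> four_block_perms (m + 3)"
    using inflate_simple_four_block m by auto
  then have "card ?A \<le> card (four_block_perms (m + 3))"
    by (rule card_inj_on_le[OF inflate_inj_on_simple[OF m] _ fin])
  then show ?thesis by (simp add: card_cartesian_product UNIV_bool algebra_simps)
qed

lemma four_block_perms_not_simple:
  assumes n: "n \<ge> 5"
  shows "four_block_perms n \<inter> simple_perms n = {}"
proof (intro equalityI subsetI)
  fix p assume p: "p \<in> four_block_perms n \<inter> simple_perms n"
  then obtain x f where x: "x \<in> {1..n - 3}" and "p ` {x..x + 3} = {f..f + 3}"
    by (auto simp: four_block_perms_def)
  then have "is_block n p {x..x + 3}"
    unfolding is_block_def using n by (intro conjI exI[of _ x] exI[of _ "x + 3"] exI) auto
  then have "{x..x + 3} = {1..n}" using simple_perms_block[of p n x "x + 3"] p by simp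
  then have "card {x..x + 3} = card {1..n}" by (simp only:)
  then show "p \<in> {}" using n by simp
qed simp

lemma num_simple_eq: "num_simple n = card (simple_perms n)"
  by (simp add: num_simple_def simple_perms_def)

lemma card_simple_upper:
  assumes n: "n \<ge> 5"
  shows "card (simple_perms n) + card (four_block_perms n) \<le> card (corner_free n)"
proof -
  have fin: "finite (corner_free n)" by (simp add: corner_free_def)
  have sub: "simple_perms n \<union> four_block_perms n \<subseteq> corner_free n"
    using simple_perms_subset_corner_free[of n] n by (auto simp: four_block_perms_def)
  have "card (simple_perms n) + card (four_block_perms n) = card (simple_perms n \<union> four_block_perms n)"
    using four_block_perms_not_simple[OF n] sub finite_subset[OF _ fin]
    by (intro card_Un_disjoint[symmetric]) (auto simp: Int_commute)
  also have "\<dots> \<le> card (corner_free n)" by (rule card_mono[OF fin sub])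
  finally show ?thesis .
qed

lemma card_simple_lower:
  assumes n: "n \<ge> 4"
  shows "card (corner_free n) \<le> card (simple_perms n) + card (four_block_perms n) + card (wide_block_perms n)"
proof -
  have "finite (simple_perms n)" "finite (four_block_perms n)" "finite (wide_block_perms n)"
    using finite_subset[OF simple_perms_subset_perms[of n]]
    by (auto simp: four_block_perms_def corner_free_def wide_block_perms_def)
  then have "card (corner_free n) \<le> card (simple_perms n \<union> (four_block_perms n \<union> wide_block_perms n))"
    using corner_free_not_simple[OF n] by (intro card_mono) auto
  also have "\<dots> \<le> card (simple_perms n) + (card (four_block_perms n) + card (wide_block_perms n))"
    by (intro order.trans[OF card_Un_le] add_left_mono card_Un_le)
  finally show ?thesis by simp
qed

text
  \<open>A first approximation: almost all adjacency-free permutations are simple. It is needed to replace simple permutations by adjacency-free ones in the lower bound for blocks of length four. The four corners cost \<open>4 (m - 1)!\<close>,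
  blocks of length four at most \<open>10 (m - 1)!\<close> and longer ones \<open>1680 (m - 1)!\<close>.\<close>
lemma card_simple_crude_lower:
  assumes m: "m \<ge> 8"
  shows "card (adj_free m) \<le> card (simple_perms m) + 1700 * fact (m - 1)"
proof -
  define k where "k = m - 3"
  have k: "m = k + 3" "k \<ge> 5" using m by (auto simp: k_def)
  have "corner_count m + corner_count (k + 2) = card (adj_free (k + 2))"
    using corner_count_Suc[of "k + 2"] k by (simp add: numeral_eq_Suc)
  then have C: "corner_count m \<le> fact (k + 2)" using card_adj_free_le[of "k + 2"] by linarith
  have f2: "fact (k + 2) = (k + 2) * ((k + 1) * (fact k :: nat))" by (simp add: numeral_eq_Suc)
  have f: "fact k \<le> (fact (k + 2) :: nat)" by (rule fact_mono_nat) simp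
  have "card (four_block_perms m) \<le> 2 * k * card (adj_free k) + 8 * fact k"
    using card_four_block_perms_le[of k] k by simp
  also have "\<dots> \<le> 2 * k * fact k + 8 * fact k"
    by (intro add_mono mult_le_mono card_adj_free_le order.refl)
  also have "\<dots> \<le> 2 * fact (k + 2) + 8 * fact (k + 2)"
  proof (intro add_mono mult_le_mono2 f)
    have "k * fact k \<le> (fact (k + 2) :: nat)"
      unfolding f2 by (rule order.trans[OF mult_le_mono1[of k "(k + 2) * (k + 1)"]]) (auto simp: algebra_simps)
    then show "2 * k * fact k \<le> 2 * (fact (k + 2) :: nat)" by simp
  qed
  finally have F: "card (four_block_perms m) \<le> 10 * fact (k + 2)" by simp
  have W: "card (wide_block_perms m) \<le> 1680 * fact (k + 2)"
    using card_wide_block_perms[OF m] f k by simp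
  have "card (corner_free m) + 4 * corner_count m = card (adj_free m) + 2 * opposite_corners_count m"
    using card_corner_free[of m] m by simp
  moreover have "card (corner_free m) \<le> card (simple_perms m) + card (four_block_perms m) + card (wide_block_perms m)"
    using card_simple_lower[of m] m by simp
  moreover have "m - 1 = k + 2" using k by simp
  ultimately show ?thesis using C F W by simp
qed

lemma card_simple_expansion:
  assumes n: "n \<ge> 11"
  shows "\<bar>real (card (simple_perms n)) - (real (card (adj_free n)) - 4 * real (card (adj_free (n - 1)))
      + 6 * real (card (adj_free (n - 2))) - 2 * real (n - 3) * real (card (adj_free (n - 3))))\<bar> \<le> 3408 * fact (n - 3)"
proof -
  define m where "m = n - 3"
  have m: "n = m + 3" "m \<ge> 8" using n by (auto simp: m_def)
  let ?s = "real (card (simple_perms n))" and ?h = "real m * real (card (adj_free m))"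
    and ?c = "real (card (corner_free n))" and ?f = "real (card (four_block_perms n))"
  have f: "m * fact (m - 1) = (fact m :: nat)" using m by (simp add: fact_reduce)
  have "m * card (adj_free m) \<le> m * card (simple_perms m) + 1700 * (m * fact (m - 1))"
    using mult_le_mono2[OF card_simple_crude_lower[OF m(2)], of m] by (simp add: algebra_simps)
  also have "\<dots> = m * card (simple_perms m) + 1700 * fact m" unfolding f ..
  finally have "2 * (m * card (adj_free m)) \<le> card (four_block_perms n) + 3400 * fact m"
    using card_four_block_perms_ge[of m] m by simp
  then have "real (2 * (m * card (adj_free m))) \<le> real (card (four_block_perms n) + 3400 * fact m)"
    by (simp only: of_nat_le_iff)
  then have F1: "2 * ?h \<le> ?f + 3400 * fact m" by simp
  have "card (four_block_perms n) \<le> 2 * (m * card (adj_free m)) + 8 * fact m"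
    using card_four_block_perms_le[of m] m by (simp add: mult.assoc)
  then have "real (card (four_block_perms n)) \<le> real (2 * (m * card (adj_free m)) + 8 * fact m)"
    by (simp only: of_nat_le_iff)
  then have F2: "?f \<le> 2 * ?h + 8 * fact m" by simp
  have "real (card (wide_block_perms n)) \<le> real (1680 * fact m)"
    using card_wide_block_perms[of n] n by (simp only: of_nat_le_iff m_def)
  then have W: "real (card (wide_block_perms n)) \<le> 1680 * fact m" by simp
  have U: "?s + ?f \<le> ?c"
    using card_simple_upper[of n] n by (simp only: of_nat_add[symmetric] of_nat_le_iff)
  have L: "?c \<le> ?s + ?f + real (card (wide_block_perms n))"
    using card_simple_lower[of n] n by (simp only: of_nat_add[symmetric] of_nat_le_iff)
  have "\<bar>?s - (?c - 2 * ?h)\<bar> \<le> 3400 * fact m"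
    using F1 F2 W U L by linarith
  moreover have "\<bar>?c - (real (card (adj_free n)) - 4 * real (card (adj_free (n - 1)))
      + 6 * real (card (adj_free (n - 2))))\<bar> \<le> 8 * fact m"
    using card_corner_free_expansion[of n] n by (simp add: m_def)
  ultimately show ?thesis unfolding m_def[symmetric] by linarith
qed

section \<open>The asymptotic expansion\<close>

text \<open>For \<open>n > 2 k\<close> the shift at most halves the argument, which accounts for the factor 8.\<close>
lemma bigo_inverse_cube_shift:
  assumes "f \<in> O(\<lambda>n. 1 / real n ^ 3)"
  shows "(\<lambda>n. f (n - k)) \<in> O(\<lambda>n. 1 / real n ^ 3)"
proof -
  have "filterlim (\<lambda>n. n - k) at_top sequentially"
    by (rule filterlim_minus_const_nat_at_top)
  then have "(\<lambda>n. f (n - k)) \<in> O(\<lambda>n. 1 / real (n - k) ^ 3)"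
    by (rule landau_o.big.compose[OF assms])
  also have "(\<lambda>n. 1 / real (n - k) ^ 3) \<in> O(\<lambda>n. 1 / real n ^ 3)"
  proof (rule bigoI[of _ 8])
    show "\<forall>\<^sub>F n in sequentially. norm (1 / real (n - k) ^ 3) \<le> 8 * norm (1 / real n ^ 3)"
      using eventually_ge_at_top[of "2 * k + 1"]
    proof eventually_elim
      case (elim n)
      then have "real n \<le> 2 * real (n - k)" by (simp add: of_nat_diff)
      then have "real n ^ 3 \<le> (2 * real (n - k)) ^ 3" by (intro power_mono) auto
      then have "real n ^ 3 \<le> 8 * real (n - k) ^ 3" by (simp add: power_mult_distrib)
      moreover have "real n ^ 3 > 0" "real (n - k) ^ 3 > 0" using elim by auto
      ultimately show ?case by (simp add: divide_simps)
    qed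
  qed
  finally show ?thesis .
qed

lemma simple_ratio_expansion:
  defines "h \<equiv> adj_free_ratio"
  shows "(\<lambda>n. real (num_simple n) / fact n - (h n - 4 / real n * h (n - 1) + 6 / (real n * (real n - 1)) * h (n - 2)
      - 2 * (real n - 3) / (real n * (real n - 1) * (real n - 2)) * h (n - 3))) \<in> O(\<lambda>n. 1 / real n ^ 3)"
proof -
  have "(\<lambda>n. real (num_simple n) / fact n - (h n - 4 / real n * h (n - 1) + 6 / (real n * (real n - 1)) * h (n - 2)
      - 2 * (real n - 3) / (real n * (real n - 1) * (real n - 2)) * h (n - 3)))
      \<in> O(\<lambda>n. 3408 / (real n * (real n - 1) * (real n - 2)))"
  proof (rule bigoI[of _ 1], rule eventually_mono[OF eventually_ge_at_top[of "11::nat"]])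
    fix n :: nat assume n: "11 \<le> n"
    define m where "m = n - 3"
    have m: "n = m + 3" using n by (simp add: m_def)
    let ?H = "\<lambda>k. real (card (adj_free k))"
    have H: "?H k = h k * fact k" for k by (simp add: h_def adj_free_ratio_def)
    have idx: "m + 3 - 1 = m + 2" "m + 3 - 2 = m + 1" "m + 3 - 3 = m" "real (m + 3) = real m + 3"
       "real m + 3 - 1 = real m + 2" "real m + 3 - 2 = real m + 1" "real m + 3 - 3 = real m" by simp_all
    have f: "fact (m + 1) = (real m + 1) * fact m" "fact (m + 2) = (real m + 2) * ((real m + 1) * fact m)"
      "fact (m + 3) = (real m + 3) * ((real m + 2) * ((real m + 1) * fact m))"
      by (simp_all add: numeral_eq_Suc algebra_simps)
    have nz: "real m + 1 \<noteq> 0" "real m + 2 \<noteq> 0" "real m + 3 \<noteq> 0" "fact m \<noteq> (0::real)" by auto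
    have "\<bar>real (num_simple n) - (?H n - 4 * ?H (n - 1) + 6 * ?H (n - 2) - 2 * real (n - 3) * ?H (n - 3))\<bar> / fact n
        \<le> 3408 * fact (n - 3) / fact n"
      unfolding num_simple_eq using card_simple_expansion[OF n] by (intro divide_right_mono) auto
    then have "\<bar>(real (num_simple n) - (?H n - 4 * ?H (n - 1) + 6 * ?H (n - 2) - 2 * real (n - 3) * ?H (n - 3))) / fact n\<bar>
        \<le> 3408 * fact (n - 3) / fact n"
      by (simp add: abs_divide)
    also have "(real (num_simple n) - (?H n - 4 * ?H (n - 1) + 6 * ?H (n - 2) - 2 * real (n - 3) * ?H (n - 3))) / fact n
      = real (num_simple n) / fact n - (h n - 4 / real n * h (n - 1) + 6 / (real n * (real n - 1)) * h (n - 2)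
      - 2 * (real n - 3) / (real n * (real n - 1) * (real n - 2)) * h (n - 3))"
      unfolding m H idx unfolding f using nz
      by (simp add: diff_divide_distrib add_divide_distrib mult.assoc)
    also have "3408 * fact (n - 3) / fact n = 3408 / (real n * (real n - 1) * (real n - 2))"
      unfolding m idx unfolding f using nz by simp
    finally show "norm (real (num_simple n) / fact n - (h n - 4 / real n * h (n - 1) + 6 / (real n * (real n - 1)) * h (n - 2)
      - 2 * (real n - 3) / (real n * (real n - 1) * (real n - 2)) * h (n - 3)))
      \<le> 1 * norm (3408 / (real n * (real n - 1) * (real n - 2)))"
      unfolding real_norm_def mult_1_left by (rule order.trans[OF _ abs_ge_self])
  qed
  also have "(\<lambda>n. 3408 / (real n * (real n - 1) * (real n - 2))) \<in> O(\<lambda>n. 1 / real n ^ 3)"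
    by real_asymp
  finally show ?thesis .
qed

theorem theorem5:
  shows "\<exists>E :: nat \<Rightarrow> real. E \<in> O[at_top](\<lambda>n. 1 / real n ^ 3) \<and>
    (\<forall>n\<ge>2. real (num_simple n) =
       fact n / (exp 1)\<^sup>2 * (1 - 4 / real n + 2 / (real n * (real n - 1)) + E n))"
proof (intro exI conjI allI impI)
  define E where "E n = (exp 1)\<^sup>2 * (real (num_simple n) / fact n) - (1 - 4 / real n + 2 / (real n * (real n - 1)))" for n
  define h where "h = adj_free_ratio"
  define e where "e n = h n - exp (-2) * (1 - 2 / real n ^ 2)" for n
  define R where "R n = real (num_simple n) / fact n - (h n - 4 / real n * h (n - 1) + 6 / (real n * (real n - 1)) * h (n - 2)
      - 2 * (real n - 3) / (real n * (real n - 1) * (real n - 2)) * h (n - 3))" for n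
  define G where "G n = (1 - 2 / real n ^ 2) - 4 / real n * (1 - 2 / (real n - 1) ^ 2)
      + 6 / (real n * (real n - 1)) * (1 - 2 / (real n - 2) ^ 2)
      - 2 * (real n - 3) / (real n * (real n - 1) * (real n - 2)) * (1 - 2 / (real n - 3) ^ 2)
      - (1 - 4 / real n + 2 / (real n * (real n - 1)))" for n :: nat
  show "real (num_simple n) = fact n / (exp 1)\<^sup>2 * (1 - 4 / real n + 2 / (real n * (real n - 1)) + E n)" for n
    by (simp add: E_def)
  have e2: "(exp 1)\<^sup>2 * exp (-2) = (1 :: real)"
    by (simp add: exp_double[symmetric] exp_minus)
  have eO: "e \<in> O(\<lambda>n. 1 / real n ^ 3)"
    using adj_free_ratio_expansion by (simp add: e_def[abs_def] h_def)
  have scaled: "(\<lambda>n. c n * e (n - k)) \<in> O(\<lambda>n. 1 / real n ^ 3)" if "c \<in> O(\<lambda>_. 1 :: real)" for c k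
    using landau_o.big_mult[OF that bigo_inverse_cube_shift[OF eO, of k]] by simp
  (* Substituting h n = exp (-2) * (1 - 2 / n^2) + e n splits E into the counting error R, the shifted
     errors e, and the rational function G, in which all terms up to order 2 cancel. *)
  have "(\<lambda>n. (exp 1)\<^sup>2 * (R n + (e n - 4 / real n * e (n - 1) + 6 / (real n * (real n - 1)) * e (n - 2)
      - 2 * (real n - 3) / (real n * (real n - 1) * (real n - 2)) * e (n - 3))) + G n) \<in> O(\<lambda>n. 1 / real n ^ 3)"
  proof (intro sum_in_bigo landau_o.big.cmult_in_iff[THEN iffD2] scaled eO)
    show "R \<in> O(\<lambda>n. 1 / real n ^ 3)"
      using simple_ratio_expansion by (simp add: R_def[abs_def] h_def)
    show "G \<in> O(\<lambda>n. 1 / real n ^ 3)"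
      unfolding G_def by real_asymp
    show "(\<lambda>n. 4 / real n) \<in> O(\<lambda>_. 1)" by real_asymp
    show "(\<lambda>n. 6 / (real n * (real n - 1))) \<in> O(\<lambda>_. 1)" by real_asymp
    show "(\<lambda>n. 2 * (real n - 3) / (real n * (real n - 1) * (real n - 2))) \<in> O(\<lambda>_. 1)" by real_asymp
  qed simp_all
  moreover have "\<forall>\<^sub>F n in at_top. (exp 1)\<^sup>2 * (R n + (e n - 4 / real n * e (n - 1) + 6 / (real n * (real n - 1)) * e (n - 2)
      - 2 * (real n - 3) / (real n * (real n - 1) * (real n - 2)) * e (n - 3))) + G n = E n"
    using eventually_ge_at_top[of 4]
  proof eventually_elim
    case (elim n)
    have r: "real (n - 1) = real n - 1" "real (n - 2) = real n - 2" "real (n - 3) = real n - 3"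
      using elim by (auto simp: of_nat_diff)
    define a b c where "a = 4 / real n" and "b = 6 / (real n * (real n - 1))"
      and "c = 2 * (real n - 3) / (real n * (real n - 1) * (real n - 2))"
    show ?case
      unfolding E_def R_def e_def G_def r a_def[symmetric] b_def[symmetric] c_def[symmetric]
      using e2 by algebra
  qed
  ultimately show "E \<in> O[at_top](\<lambda>n. 1 / real n ^ 3)"
    by (simp add: landau_o.big.in_cong)
qed

end
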